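(* Let $m,N,d$ be positive integers and let $F_I=0$, $I=1,\dots,m$, be a system of partial differential equations in independent variables $x^1,\dots,x^d$ for an unknown vector function $\boldsymbol{u}=(u^1,\dots,u^N)^T$; put $\mathcal{F}=(F_1,\dots,F_m)^T$. Suppose there exist differential operators in total derivatives $$A_i=A_i^0+\sum_{j=1}^d A_i^j D_{x^j},\quad B_i=B_i^0+\sum_{j=1}^d B_i^j D_{x^j}\ (i=1,2),\quad L=L^0+\sum_{k=1}^d L^kD_{x^k},\quad M=M^0+\sum_{k=1}^d M^kD_{x^k},$$ whose coefficients are local functions, where $A_i^j,B_i^j$ ($i=1,2$, $j=1,\dots,d$) are scalar, $A_i^0,B_i^0$ are $m\times m$ matrices, $L^k$ ($k=0,\dots,d$) are $N\times m$ matrices and $M^k$ ($k=0,\dots,d$) are $m\times N$ matrices, such that the following hold on $\mathrm{Sol}_{\mathcal{F}}$: (i) $[A_1,A_2]=0$; (ii) $[B_1,B_2]=0$; (iii) $\ell_{\mathcal{F}}^\dagger=L\circ(B_1A_2-B_2A_1)$; (iv) $A_1B_2-A_2B_1=M\circ\ell_{\mathcal{F}}^\dagger$; (v) there exist $p,q\in\{1,\dots,d\}$, $p\neq q$, such that $D_{x^p}\tilde{\boldsymbol{\gamma}}$ and $D_{x^q}\tilde{\boldsymbol{\gamma}}$ can be expressed from the relations $$A_i(\tilde{\boldsymbol{\gamma}})=B_i(\boldsymbol{\gamma}),\quad i=1,2.$$ Then the relations $A_i(\tilde{\boldsymbol{\gamma}})=B_i(\boldsymbol{\gamma})$, $i=1,2$,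 define an adjoint recursion operator for the system $\mathcal{F}=0$, i.e., whenever $\boldsymbol{\gamma}$ is a cosymmetry of the system, then so is $\tilde{\boldsymbol{\gamma}}$ defined by these relations.
   Context: Jet variables: for a multi-index of nonnegative integers $(i_1,\dots,i_d)$ put $u^\alpha_{i_1\dots i_d}=\partial^{i_1+\cdots+i_d}u^\alpha/\partial(x^1)^{i_1}\cdots\partial(x^d)^{i_d}$, $u^\alpha_{0\cdots0}=u^\alpha$. The $x^i$ and $u^\alpha_{i_1\dots i_d}$ are regarded as independent coordinates on the infinite jet space. A local function is a function of $\vec x=(x^1,\dots,x^d)$, $\boldsymbol{u}$ and finitely many derivatives of $\boldsymbol{u}$. All functions are assumed locally meromorphic in all their arguments. The components $F_I$ are local functions. Total derivatives: $D_{x^j}=\frac{\partial}{\partial x^j}+\sum_{\alpha=1}^N\sum_{i_1,\dots,i_d\ge 0}u^\alpha_{i_1\dots i_{j-1}(i_j+1)i_{j+1}\dots i_d}\frac{\partial}{\partial u^\alpha_{i_1\dots i_d}}$. $\mathrm{Sol}_{\mathcal{F}}$ is the submanifold of the infinite jet space defined by the system $F_I=0$ and all its differential consequences $D_{x^1}^{i_1}\cdots D_{x^d}^{i_d}F_I=0$. All equations (including operator identities and the cosymmetry condition) are required to hold only on $\mathrm{Sol}_{\mathcal{F}}$, or on a differential covering of it, not on the whole jet space. A differential covering of $\mathrm{Sol}_{\mathcal{F}}$ is obtained by adjoining further coordinates (nonlocal variables) and extending the total derivatives to these so that the extended operators, again denoted $D_{x^j}$, still commute with each other. Linearization: for a local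 function $f$, $\ell_f=\sum_{\alpha=1}^N\sum_{i_1,\dots,i_d\ge0}\frac{\partial f}{\partial u^\alpha_{i_1\dots i_d}}D_{x^1}^{i_1}\cdots D_{x^d}^{i_d}$ (acting on $N$-component vectors $\boldsymbol{U}=(U^1,\dots,U^N)^T$, the $\alpha$-th summand acting on $U^\alpha$), and $\ell_{\mathcal{F}}=(\ell_{F_1},\dots,\ell_{F_m})^T$, an $m\times N$ matrix differential operator. Formal adjoint: for $Q=Q^0+\sum_{k=1}^q\sum_{j_1,\dots,j_k=1}^d Q^{j_1\dots j_k}D_{x^{j_1}}\cdots D_{x^{j_k}}$ with matrix-valued local coefficients, $Q^\dagger=(Q^0)^T+\sum_{k=1}^q\sum_{j_1,\dots,j_k=1}^d(-1)^kD_{x^{j_1}}\cdots D_{x^{j_k}}\circ(Q^{j_1\dots j_k})^T$. A cosymmetry is an $m$-component vector function $\boldsymbol{\gamma}$ (which may depend on nonlocal variables in addition to local ones) satisfying $\ell_{\mathcal{F}}^\dagger(\boldsymbol{\gamma})=0$ on $\mathrm{Sol}_{\mathcal{F}}$ or on a covering of it. The vector $\tilde{\boldsymbol{\gamma}}$ defined by the relations in (v) may involve additional nonlocal variables. An adjoint recursion operator is understood as a Bäcklund auto-transformation of $\ell_{\mathcal{F}}^\dagger(\boldsymbol{\gamma})=0$, i.e. a system of relations between $\boldsymbol{\gamma}$ and $\tilde{\boldsymbol{\gamma}}$ sending solutions to solutions. *)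

theory Defs
  imports "HOL-Analysis.Analysis" "HOL-Library.Groups_Big_Fun"
begin

section \<open>Meromorphic functions of possibly infinitely many coordinates\<close>

text \<open>
  A point assigns a complex value to every coordinate; spaces of points carry the product topology.
\<close>

type_synonym 'c pt = "'c \<Rightarrow> complex"
type_synonym 'c pfun = "'c pt \<Rightarrow> complex"

definition depends_only :: "'c pt set \<Rightarrow> 'c set \<Rightarrow> 'c pfun \<Rightarrow> bool" where
  "depends_only V S f \<longleftrightarrow> (\<forall>z\<in>V. \<forall>z'\<in>V. (\<forall>c\<in>S. z c = z' c) \<longrightarrow> f z = f z')"

text \<open>
  Holomorphic functions of the coordinates in a finite set \<open>S\<close>: continuous, and holomorphic in each
  variable separately.
\<close>

definition holo :: "'c pt set \<Rightarrow> 'c set \<Rightarrow> 'c pfun \<Rightarrow> bool" where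
  "holo V S f \<longleftrightarrow> depends_only V S f \<and> continuous_on V f \<and>
     (\<forall>z\<in>V. \<forall>c\<in>S. (\<lambda>t. f (z(c := t))) field_differentiable (at (z c)))"

definition regular :: "'c pfun \<Rightarrow> 'c pt \<Rightarrow> bool" where
  "regular f z \<longleftrightarrow> (\<exists>V S. open V \<and> z \<in> V \<and> finite S \<and> holo V S f)"

text \<open>
  Locally a quotient of holomorphic functions, the denominator being nonzero on a dense set.
  HOL functions are total: the values on the zero set of the denominator are irrelevant, and all
  identities below are only evaluated at generic points.
\<close>

definition meromorphic_function :: "'c pt set \<Rightarrow> 'c pfun \<Rightarrow> bool" where
  "meromorphic_function \<Omega> f \<longleftrightarrow> (\<exists>S. finite S \<and> depends_only \<Omega> S f \<and>
     (\<forall>z\<in>\<Omega>. \<exists>V g h. open V \<and> z \<in> V \<and> V \<subseteq> \<Omega> \<and> holo V S g \<and> holo V S h \<and>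
        V \<subseteq> closure {y\<in>V. h y \<noteq> 0} \<and> (\<forall>y\<in>V. h y \<noteq> 0 \<longrightarrow> f y = g y / h y)))"

text \<open>
  A property holds generically on \<open>S\<close> if it holds on a dense relatively open subset of \<open>S\<close>;
  this is the sense in which meromorphic functions on \<open>S\<close> are equal.
\<close>

definition generically :: "'c pt set \<Rightarrow> ('c pt \<Rightarrow> bool) \<Rightarrow> bool" where
  "generically S P \<longleftrightarrow> (\<exists>U. open U \<and> S \<subseteq> closure (S \<inter> U) \<and> (\<forall>z\<in>S \<inter> U. P z))"

definition eq_on :: "'c pt set \<Rightarrow> 'c pfun \<Rightarrow> 'c pfun \<Rightarrow> bool" where
  "eq_on S f g \<longleftrightarrow> generically S (\<lambda>z. f z = g z)"

text \<open>
  Meromorphic on \<open>\<Omega>\<close> and restricting to a meromorphic function on \<open>S\<close>, i.e. the poles are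
  nowhere dense in \<open>S\<close>.
\<close>

definition meromorphic_along :: "'c pt set \<Rightarrow> 'c pt set \<Rightarrow> 'c pfun \<Rightarrow> bool" where
  "meromorphic_along \<Omega> S f \<longleftrightarrow> meromorphic_function \<Omega> f \<and> generically S (regular f)"

definition partial :: "'c \<Rightarrow> 'c pfun \<Rightarrow> 'c pfun" where
  "partial c f z = deriv (\<lambda>t. f (z(c := t))) (z c)"

text \<open>
  \<open>Sum_any\<close> is the sum over all indices with nonzero summand; at regular points of \<open>f\<close> only
  finitely many partial derivatives are nonzero.
\<close>

definition differential :: "'c pfun \<Rightarrow> 'c pt \<Rightarrow> ('c \<Rightarrow> complex) \<Rightarrow> complex" where
  "differential f z v = Sum_any (\<lambda>c. partial c f z * v c)"

definition lie :: "('c \<Rightarrow> 'c pfun) \<Rightarrow> 'c pfun \<Rightarrow> 'c pfun" where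
  "lie v f z = differential f z (\<lambda>c. v c z)"

definition tangent_space :: "'c pt set \<Rightarrow> 'c pt \<Rightarrow> ('c \<Rightarrow> complex) set" where
  "tangent_space S z = {v. \<exists>\<phi> :: complex \<Rightarrow> 'c pt. \<phi> 0 = z \<and> (\<forall>\<^sub>F t in nhds 0. \<phi> t \<in> S) \<and>
     (\<forall>c. ((\<lambda>t. \<phi> t c) has_field_derivative v c) (at 0))}"


section \<open>Infinite jet space and total derivatives\<close>

text \<open>
  The independent variables are indexed by \<open>'d\<close>, whose linear order fixes the order of the factors
  in \<open>D\<^sub>1^i\<^sub>1 \<dots> D\<^sub>d^i\<^sub>d\<close>; multi-indices are functions \<open>'d \<Rightarrow> nat\<close>.
\<close>

datatype ('d, 'n) jcoord = Indep 'd | Dep 'n "'d \<Rightarrow> nat"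

type_synonym ('d, 'n) jet = "('d, 'n) jcoord pt"
type_synonym ('d, 'n) jfun = "('d, 'n) jcoord pfun"

definition total_field :: "'d \<Rightarrow> ('d, 'n) jcoord \<Rightarrow> ('d, 'n) jfun" where
  "total_field j c z = (case c of
       Indep i \<Rightarrow> (if i = j then 1 else 0)
     | Dep \<alpha> \<sigma> \<Rightarrow> z (Dep \<alpha> (\<sigma>(j := Suc (\<sigma> j)))))"

definition tot :: "'d \<Rightarrow> ('d, 'n) jfun \<Rightarrow> ('d, 'n) jfun" where
  "tot j = lie (total_field j)"

definition multi_pow :: "('d :: {finite, linorder} \<Rightarrow> 'a \<Rightarrow> 'a) \<Rightarrow> ('d \<Rightarrow> nat) \<Rightarrow> 'a \<Rightarrow> 'a" where
  "multi_pow D \<sigma> = foldr (\<lambda>j. D j ^^ \<sigma> j) (sorted_list_of_set UNIV)"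

definition solution_set ::
  "('d :: {finite, linorder}, 'n) jet set \<Rightarrow> ('m \<Rightarrow> ('d, 'n) jfun) \<Rightarrow> ('d, 'n) jet set" where
  "solution_set \<Omega> F = {z\<in>\<Omega>. \<forall>I. regular (F I) z \<and> (\<forall>\<sigma>. multi_pow tot \<sigma> (F I) z = 0)}"

text \<open>
  The solution set is a submanifold with the system and its differential consequences as defining
  equations: its tangent spaces are the common kernels of their differentials.
\<close>

definition regular_system ::
  "('d :: {finite, linorder}, 'n) jet set \<Rightarrow> ('m \<Rightarrow> ('d, 'n) jfun) \<Rightarrow> bool" where
  "regular_system \<Omega> F \<longleftrightarrow> (\<forall>z\<in>solution_set \<Omega> F.
     tangent_space (solution_set \<Omega> F) z =
       {v. \<forall>I \<sigma>. differential (multi_pow tot \<sigma> (F I)) z v = 0})"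


section \<open>Differential operators in total derivatives\<close>

text \<open>
  A scalar operator is given by its coefficients: \<open>P\<close> stands for \<open>\<Sum>\<^sub>\<sigma> P \<sigma> D^\<sigma>\<close>. A matrix operator
  is a matrix of scalar operators.
\<close>

type_synonym ('d, 'n) dop = "('d \<Rightarrow> nat) \<Rightarrow> ('d, 'n) jfun"
type_synonym ('r, 's, 'd, 'n) mop = "'r \<Rightarrow> 's \<Rightarrow> ('d, 'n) dop"

definition mult_op :: "('d, 'n) jfun \<Rightarrow> ('d, 'n) dop" where
  "mult_op a \<tau> z = (if \<tau> = (\<lambda>_. 0) then a z else 0)"

text \<open>The composition \<open>D\<^sub>j \<circ> Q\<close>, from \<open>D\<^sub>j \<circ> a D^\<tau> = D\<^sub>j(a) D^\<tau> + a D\<^sub>j D^\<tau>\<close>.\<close>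

definition tot_comp :: "'d \<Rightarrow> ('d, 'n) dop \<Rightarrow> ('d, 'n) dop" where
  "tot_comp j Q \<tau> z = tot j (Q \<tau>) z + (if \<tau> j > 0 then Q (\<tau>(j := \<tau> j - 1)) z else 0)"

definition dop_comp ::
  "('d :: {finite, linorder}, 'n) dop \<Rightarrow> ('d, 'n) dop \<Rightarrow> ('d, 'n) dop" where
  "dop_comp P Q \<tau> z = Sum_any (\<lambda>\<sigma>. P \<sigma> z * multi_pow tot_comp \<sigma> Q \<tau> z)"

definition dop_adjoint :: "('d :: {finite, linorder}, 'n) dop \<Rightarrow> ('d, 'n) dop" where
  "dop_adjoint P \<tau> z =
     Sum_any (\<lambda>\<sigma>. (- 1) ^ (\<Sum>j\<in>UNIV. \<sigma> j) * multi_pow tot_comp \<sigma> (mult_op (P \<sigma>)) \<tau> z)"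

definition mop_comp ::
  "('r, 's :: finite, 'd :: {finite, linorder}, 'n) mop \<Rightarrow> ('s, 't, 'd, 'n) mop \<Rightarrow> ('r, 't, 'd, 'n) mop"
    (infixl "\<odot>" 70) where
  "(P \<odot> Q) r t \<tau> z = (\<Sum>s\<in>UNIV. dop_comp (P r s) (Q s t) \<tau> z)"

definition mop_diff ::
  "('r, 's, 'd, 'n) mop \<Rightarrow> ('r, 's, 'd, 'n) mop \<Rightarrow> ('r, 's, 'd, 'n) mop" (infixl "\<ominus>" 65) where
  "(P \<ominus> Q) r s \<tau> z = P r s \<tau> z - Q r s \<tau> z"

definition mop_zero :: "('r, 's, 'd, 'n) mop" where
  "mop_zero r s \<tau> z = 0"

definition mop_adjoint ::
  "('r, 's, 'd :: {finite, linorder}, 'n) mop \<Rightarrow> ('s, 'r, 'd, 'n) mop" where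
  "mop_adjoint P s r = dop_adjoint (P r s)"

definition mop_eq_on ::
  "('d, 'n) jet set \<Rightarrow> ('r, 's, 'd, 'n) mop \<Rightarrow> ('r, 's, 'd, 'n) mop \<Rightarrow> bool" where
  "mop_eq_on S P Q \<longleftrightarrow> (\<forall>r s \<tau>. eq_on S (P r s \<tau>) (Q r s \<tau>))"

text \<open>The operator \<open>C\<^sup>0 + \<Sum>\<^sub>j C\<^sup>j D\<^sub>j\<close> with matrix coefficients.\<close>

definition first_order ::
  "('r \<Rightarrow> 's \<Rightarrow> ('d :: finite, 'n) jfun) \<Rightarrow> ('d \<Rightarrow> 'r \<Rightarrow> 's \<Rightarrow> ('d, 'n) jfun) \<Rightarrow> ('r, 's, 'd, 'n) mop"
  where
  "first_order C0 C r s \<tau> z = (if \<tau> = (\<lambda>_. 0) then C0 r s z else 0) +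
     (\<Sum>j\<in>UNIV. if \<tau> = (\<lambda>i. if i = j then 1 else 0) then C j r s z else 0)"

definition scalar_mat :: "('d, 'n) jfun \<Rightarrow> 'r \<Rightarrow> 'r \<Rightarrow> ('d, 'n) jfun" where
  "scalar_mat a r s z = (if r = s then a z else 0)"

definition linearization :: "('m \<Rightarrow> ('d, 'n) jfun) \<Rightarrow> ('m, 'n, 'd, 'n) mop" where
  "linearization F I \<alpha> \<sigma> = partial (Dep \<alpha> \<sigma>) (F I)"


section \<open>Differential coverings and cosymmetries\<close>

text \<open>
  The nonlocal variables are the coordinates \<open>Inr a\<close>; \<open>X j a\<close> is the derivative \<open>D\<^sub>j\<close> of the
  nonlocal variable \<open>a\<close>.
\<close>

type_synonym ('d, 'n, 'w) cpt = "(('d, 'n) jcoord + 'w) pt"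
type_synonym ('d, 'n, 'w) cfun = "(('d, 'n) jcoord + 'w) pfun"

definition base :: "('d, 'n, 'w) cpt \<Rightarrow> ('d, 'n) jet" where
  "base z = (\<lambda>c. z (Inl c))"

definition cov_field ::
  "('d \<Rightarrow> 'w \<Rightarrow> ('d, 'n, 'w) cfun) \<Rightarrow> 'd \<Rightarrow> ('d, 'n) jcoord + 'w \<Rightarrow> ('d, 'n, 'w) cfun" where
  "cov_field X j c z = (case c of Inl b \<Rightarrow> total_field j b (base z) | Inr a \<Rightarrow> X j a z)"

definition cov_tot ::
  "('d \<Rightarrow> 'w \<Rightarrow> ('d, 'n, 'w) cfun) \<Rightarrow> 'd \<Rightarrow> ('d, 'n, 'w) cfun \<Rightarrow> ('d, 'n, 'w) cfun" where
  "cov_tot X j = lie (cov_field X j)"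

definition cov_solution_set ::
  "('d :: {finite, linorder}, 'n) jet set \<Rightarrow> ('m \<Rightarrow> ('d, 'n) jfun) \<Rightarrow>
   ('d, 'n, 'w) cpt set \<Rightarrow> ('d, 'n, 'w) cpt set" where
  "cov_solution_set \<Omega> F \<Omega>' = {z\<in>\<Omega>'. base z \<in> solution_set \<Omega> F}"

definition differential_covering ::
  "('d :: {finite, linorder}, 'n) jet set \<Rightarrow> ('m \<Rightarrow> ('d, 'n) jfun) \<Rightarrow>
   ('d, 'n, 'w) cpt set \<Rightarrow> ('d \<Rightarrow> 'w \<Rightarrow> ('d, 'n, 'w) cfun) \<Rightarrow> bool" where
  "differential_covering \<Omega> F \<Omega>' X \<longleftrightarrow>
     open \<Omega>' \<and> base ` \<Omega>' \<subseteq> \<Omega> \<and>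
     (\<forall>j a. meromorphic_along \<Omega>' (cov_solution_set \<Omega> F \<Omega>') (X j a)) \<and>
     (\<forall>f. meromorphic_along \<Omega>' (cov_solution_set \<Omega> F \<Omega>') f \<longrightarrow>
        (\<forall>i j. eq_on (cov_solution_set \<Omega> F \<Omega>')
                 (cov_tot X i (cov_tot X j f)) (cov_tot X j (cov_tot X i f))))"

definition dop_app ::
  "('d :: {finite, linorder} \<Rightarrow> 'w \<Rightarrow> ('d, 'n, 'w) cfun) \<Rightarrow> ('d, 'n) dop \<Rightarrow>
   ('d, 'n, 'w) cfun \<Rightarrow> ('d, 'n, 'w) cfun" where
  "dop_app X P f z = Sum_any (\<lambda>\<sigma>. P \<sigma> (base z) * multi_pow (cov_tot X) \<sigma> f z)"

definition mop_app ::
  "('d :: {finite, linorder} \<Rightarrow> 'w \<Rightarrow> ('d, 'n, 'w) cfun) \<Rightarrow> ('r, 's :: finite, 'd, 'n) mop \<Rightarrow>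
   ('s \<Rightarrow> ('d, 'n, 'w) cfun) \<Rightarrow> 'r \<Rightarrow> ('d, 'n, 'w) cfun" where
  "mop_app X P f r z = (\<Sum>s\<in>UNIV. dop_app X (P r s) (f s) z)"

definition cosymmetry ::
  "('d :: {finite, linorder}, 'n) jet set \<Rightarrow> ('m :: finite \<Rightarrow> ('d, 'n) jfun) \<Rightarrow>
   ('d, 'n, 'w) cpt set \<Rightarrow> ('d \<Rightarrow> 'w \<Rightarrow> ('d, 'n, 'w) cfun) \<Rightarrow> ('m \<Rightarrow> ('d, 'n, 'w) cfun) \<Rightarrow> bool" where
  "cosymmetry \<Omega> F \<Omega>' X \<gamma> \<longleftrightarrow>
     (\<forall>I. meromorphic_along \<Omega>' (cov_solution_set \<Omega> F \<Omega>') (\<gamma> I)) \<and>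
     (\<forall>\<alpha>. eq_on (cov_solution_set \<Omega> F \<Omega>')
            (mop_app X (mop_adjoint (linearization F)) \<gamma> \<alpha>) (\<lambda>_. 0))"

text \<open>
  The relations \<open>A\<^sub>i(\<gamma>') = B\<^sub>i(\<gamma>)\<close>, \<open>i = 1, 2\<close>, send cosymmetries to cosymmetries, on every covering
  with nonlocal variables indexed by \<open>'w\<close>. If \<open>\<gamma>'\<close> needs nonlocal variables beyond those of \<open>\<gamma>\<close>, the
  covering is the larger one, \<open>\<gamma>\<close> being independent of the additional variables.
\<close>

definition adjoint_recursion_operator ::
  "'w itself \<Rightarrow> ('d :: {finite, linorder}, 'n) jet set \<Rightarrow> ('m :: finite \<Rightarrow> ('d, 'n) jfun) \<Rightarrow>
   (nat \<Rightarrow> ('m, 'm, 'd, 'n) mop) \<Rightarrow> (nat \<Rightarrow> ('m, 'm, 'd, 'n) mop) \<Rightarrow> bool" where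
  "adjoint_recursion_operator _ \<Omega> F A B \<longleftrightarrow>
     (\<forall>\<Omega>' (X :: 'd \<Rightarrow> 'w \<Rightarrow> ('d, 'n, 'w) cfun) \<gamma> \<gamma>'.
        differential_covering \<Omega> F \<Omega>' X \<longrightarrow> cosymmetry \<Omega> F \<Omega>' X \<gamma> \<longrightarrow>
        (\<forall>I. meromorphic_along \<Omega>' (cov_solution_set \<Omega> F \<Omega>') (\<gamma>' I)) \<longrightarrow>
        (\<forall>i\<in>{1, 2}. \<forall>I. eq_on (cov_solution_set \<Omega> F \<Omega>')
            (mop_app X (A i) \<gamma>' I) (mop_app X (B i) \<gamma> I)) \<longrightarrow>
        cosymmetry \<Omega> F \<Omega>' X \<gamma>')"

text \<open>
  \<open>D\<^sub>p \<gamma>'\<close> and \<open>D\<^sub>q \<gamma>'\<close> can be expressed from \<open>A\<^sub>i(\<gamma>') = B\<^sub>i(\<gamma>)\<close>: given the values \<open>g0\<close> of \<open>\<gamma>'\<close>, \<open>g j\<close>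
  of \<open>D\<^sub>j \<gamma>'\<close> for \<open>j \<noteq> p, q\<close>, and \<open>b i\<close> of the right-hand sides, the relations have exactly one
  solution for \<open>D\<^sub>p \<gamma>'\<close> and \<open>D\<^sub>q \<gamma>'\<close>.
\<close>

definition solvable_for ::
  "('d, 'n) jet set \<Rightarrow> (nat \<Rightarrow> 'm :: finite \<Rightarrow> 'm \<Rightarrow> ('d :: finite, 'n) jfun) \<Rightarrow>
   (nat \<Rightarrow> 'd \<Rightarrow> ('d, 'n) jfun) \<Rightarrow> 'd \<Rightarrow> 'd \<Rightarrow> bool" where
  "solvable_for S A0 A p q \<longleftrightarrow> generically S (\<lambda>z.
     \<forall>(g0 :: 'm \<Rightarrow> complex) (g :: 'd \<Rightarrow> 'm \<Rightarrow> complex) (b :: nat \<Rightarrow> 'm \<Rightarrow> complex).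
       \<exists>!(gp, gq). \<forall>i\<in>{1, 2}. \<forall>I.
         (\<Sum>J\<in>UNIV. A0 i I J z * g0 J) + (\<Sum>j\<in>UNIV. A i j z * (g(p := gp, q := gq)) j I) = b i I)"

end

theory Submission
  imports Defs "HOL-Complex_Analysis.Cauchy_Integral_Formula"
begin

text \<open>
  On solutions, \<open>\<ell>\<^sub>F\<^sup>\<dagger>(\<gamma>') = L((B\<^sub>1 A\<^sub>2 - B\<^sub>2 A\<^sub>1)(\<gamma>')) = L((B\<^sub>1 B\<^sub>2 - B\<^sub>2 B\<^sub>1)(\<gamma>)) = 0\<close>. All these identities hold
  only at generic points of the solution set, so the work lies in showing that operators may be
  composed and applied there. Total derivatives of a function depend only on its restriction to the
  solution set, since on a regular system the total derivative fields are tangent to it and the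
  chain rule holds along the curves realising the tangent vectors. They commute on every generically
  regular function because they commute on the coordinates and mixed partial derivatives of
  holomorphic functions (by Cauchy's formula) are symmetric.
\<close>

section \<open>Holomorphic functions on product spaces\<close>

text \<open>Two difficulties shape the proof. A generic identity cannot be differentiated naively:
  it says nothing about the functions off the solution set and leaves their values on a nowhere
  dense set open. Hence every function that gets differentiated is required to be holomorphic near
  generic points (\<open>generically_regular\<close>), a class that contains all functions
  satisfying \<open>meromorphic_along\<close> and is easily seen to be closed under the derivations.
  Moreover only finitely many generic conditions can be combined, since an infinite intersection of
  dense open sets need not be open, while the vector fields have infinitely many components.
  Arguments are therefore localised to neighbourhoods on which a function depends on a fixed finite
  set of coordinates, and operators are shown to have only finitely many nonzero
  coefficients.\<close>

definition nbox :: "'c set \<Rightarrow> 'c pt \<Rightarrow> real \<Rightarrow> 'c pt set" where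
  "nbox K z e = {y. \<forall>c\<in>K. dist (y c) (z c) < e}"

lemma open_nbox: "finite K \<Longrightarrow> open (nbox K z e)"
  using product_topology_basis'[of K "\<lambda>i. ball (z i) e" id]
  by (simp add: nbox_def mem_ball dist_commute)

lemma nbox_centre: "e > 0 \<Longrightarrow> z \<in> nbox K z e"
  by (simp add: nbox_def)

text \<open>Near a point, an open set of the product topology restricts only finitely many
  coordinates, so boxes with a finite \<open>K\<close> and a single radius form a neighbourhood
  basis.\<close>

lemma open_contains_nbox:
  fixes V :: "'c pt set"
  assumes "open V" "z \<in> V"
  obtains K e where "finite K" "e > 0" "nbox K z e \<subseteq> V"
proof -
  have "openin (product_topology (\<lambda>i. euclidean) UNIV) V"
    using assms(1) unfolding open_fun_def .
  from product_topology_open_contains_basis[OF this assms(2)]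
  obtain Y where Y: "z \<in> (\<Pi>\<^sub>E i\<in>UNIV. Y i)" "\<And>i. open (Y i)" "finite {i. Y i \<noteq> UNIV}"
      "(\<Pi>\<^sub>E i\<in>UNIV. Y i) \<subseteq> V"
    by auto
  define K where "K = {i. Y i \<noteq> UNIV}"
  have "\<forall>i. \<exists>d>0. \<forall>t. dist t (z i) < d \<longrightarrow> t \<in> Y i"
    using Y(1,2) by (auto simp: open_dist PiE_def)
  then obtain d where d: "\<And>i. d i > 0" "\<And>i t. dist t (z i) < d i \<Longrightarrow> t \<in> Y i"
    by metis
  \<comment> \<open>The \<open>1\<close> keeps the minimum meaningful when \<open>K\<close> is
    empty.\<close>
  define e where "e = Min (insert 1 (d ` K))"
  have fin: "finite K" using Y(3) by (simp add: K_def)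
  have "e > 0" using fin d(1) by (simp add: e_def)
  moreover have "nbox K z e \<subseteq> V"
  proof
    fix y assume y: "y \<in> nbox K z e"
    have "y i \<in> Y i" for i
    proof (cases "i \<in> K")
      case True
      then have "dist (y i) (z i) < e" "e \<le> d i" using y fin by (auto simp: nbox_def e_def)
      then show ?thesis using d(2) by force
    qed (simp add: K_def)
    then show "y \<in> V" using Y(4) by auto
  qed
  ultimately show thesis using that fin by blast
qed

lemma continuous_on_fun_upd:
  fixes f :: "'a::topological_space \<Rightarrow> 'c \<Rightarrow> 'b::topological_space"
  assumes "continuous_on T f" "continuous_on T g"
  shows "continuous_on T (\<lambda>x. (f x)(c := g x))"
proof (rule continuous_on_coordinatewise_then_product)
  fix i
  show "continuous_on T (\<lambda>x. ((f x)(c := g x)) i)"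
    using assms(2) continuous_on_product_then_coordinatewise[OF assms(1), of i] by (cases "i = c") auto
qed

lemma open_update_vimage:
  fixes V :: "'c pt set"
  assumes "open V"
  shows "open {t. z(c := t) \<in> V}"
proof -
  have "continuous_on UNIV (\<lambda>t. z(c := t))"
    by (intro continuous_on_fun_upd continuous_intros)
  then show ?thesis using open_vimage[OF assms] by (simp add: vimage_def)
qed

lemma eventually_update_in:
  fixes V :: "'c pt set"
  assumes "open V" "z \<in> V"
  shows "\<forall>\<^sub>F t in nhds (z c). z(c := t) \<in> V"
  using open_update_vimage[OF assms(1), of z c] assms(2)
  by (intro eventually_nhds[THEN iffD2] exI[of _ "{t. z(c := t) \<in> V}"]) auto

lemma partial_update: "partial c f (z(c := t)) = deriv (\<lambda>u. f (z(c := u))) t"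
  by (simp add: partial_def)

lemma partial_cong:
  assumes "open V" "z \<in> V" "\<And>y. y \<in> V \<Longrightarrow> f y = g y"
  shows "partial c f z = partial c g z"
  unfolding partial_def
  by (intro deriv_cong_ev eventually_mono[OF eventually_update_in[OF assms(1,2)]]) (auto simp: assms(3))

lemma depends_only_update:
  assumes "depends_only V S f" "z \<in> V" "z(c := t) \<in> V" "c \<notin> S"
  shows "f (z(c := t)) = f z"
  using assms unfolding depends_only_def by (metis fun_upd_apply)

lemma depends_only_has_deriv_0:
  assumes "open V" "depends_only V S f" "z \<in> V" "c \<notin> S"
  shows "((\<lambda>t. f (z(c := t))) has_field_derivative 0) (at (z c))"
proof -
  have "\<forall>\<^sub>F t in nhds (z c). f (z(c := t)) = f z"
    by (rule eventually_mono[OF eventually_update_in[OF assms(1,3)]])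
       (rule depends_only_update[OF assms(2,3) _ assms(4)])
  from DERIV_cong_ev[OF refl this refl, of 0, THEN iffD2, OF DERIV_const] show ?thesis .
qed

lemma depends_only_partial_0:
  assumes "open V" "depends_only V S f" "z \<in> V" "c \<notin> S"
  shows "partial c f z = 0"
  unfolding partial_def using depends_only_has_deriv_0[OF assms] by (rule DERIV_imp_deriv)

text \<open>\<open>holo\<close> asks for differentiability only in the coordinates of
  \<open>S\<close>; in all others the function is locally constant. Stating the result at
  \<open>z(c := t)\<close> covers a whole coordinate line inside \<open>V\<close>, as Cauchy's
  formula requires.\<close>

lemma holo_has_partial:
  assumes "open V" "holo V S f" "z(c := t) \<in> V"
  shows "((\<lambda>u. f (z(c := u))) has_field_derivative partial c f (z(c := t))) (at t)"
proof (cases "c \<in> S")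
  case True
  then have "(\<lambda>u. f ((z(c := t))(c := u))) field_differentiable (at ((z(c := t)) c))"
    using assms unfolding holo_def by blast
  then show ?thesis by (simp add: partial_update field_differentiable_derivI)
next
  case False
  then show ?thesis
    using depends_only_has_deriv_0[of V S f "z(c := t)" c] depends_only_partial_0[of V S f "z(c := t)" c]
      assms by (simp add: holo_def)
qed

lemma holo_has_partial_at:
  assumes "open V" "holo V S f" "z \<in> V"
  shows "((\<lambda>u. f (z(c := u))) has_field_derivative partial c f z) (at (z c))"
  using holo_has_partial[OF assms(1,2), of z c "z c"] assms(3) by simp

lemma depends_only_mono: "depends_only V S f \<Longrightarrow> V' \<subseteq> V \<Longrightarrow> S \<subseteq> S' \<Longrightarrow> depends_only V' S' f"
  unfolding depends_only_def by blast

lemma holo_mono: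
  assumes "open V" "holo V S f" "V' \<subseteq> V" "S \<subseteq> S'"
  shows "holo V' S' f"
proof -
  have "(\<lambda>t. f (z(c := t))) field_differentiable (at (z c))" if "z \<in> V'" for z c
    using holo_has_partial_at[OF assms(1,2), of z c] that assms(3) unfolding field_differentiable_def by blast
  then show ?thesis
    using assms depends_only_mono continuous_on_subset unfolding holo_def by metis
qed

lemma depends_only_partial:
  assumes "open V" "depends_only V S f"
  shows "depends_only V S (partial c f)"
  unfolding depends_only_def
proof (intro ballI impI)
  fix z z' assume z: "z \<in> V" "z' \<in> V" "\<forall>c\<in>S. z c = z' c"
  show "partial c f z = partial c f z'"
  proof (cases "c \<in> S")
    case True
    \<comment> \<open>The points agree at \<open>c\<close>, so both coordinate lines are
      parametrised around the same value and can be compared at equal \<open>t\<close>.\<close>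
    have "\<forall>\<^sub>F t in nhds (z c). z(c := t) \<in> V \<and> z'(c := t) \<in> V"
      using eventually_update_in[OF assms(1) z(1), of c] eventually_update_in[OF assms(1) z(2), of c] z(3) True
      by (auto intro: eventually_conj)
    then have "\<forall>\<^sub>F t in nhds (z c). f (z(c := t)) = f (z'(c := t))"
      by eventually_elim (use assms(2) z(3) in \<open>auto simp: depends_only_def\<close>)
    then show ?thesis using z(3) True unfolding partial_def by (intro deriv_cong_ev) auto
  qed (use depends_only_partial_0[OF assms] z in auto)
qed

section \<open>Cauchy integrals and derivatives of holomorphic functions\<close>

text \<open>
  The factor \<open>2 \<pi> \<i>\<close> in the derivative of the circle path cancels against the one in Cauchy's formula.
\<close>

definition cauchy_kernel :: "complex \<Rightarrow> real \<Rightarrow> complex \<Rightarrow> real \<Rightarrow> complex" where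
  "cauchy_kernel a r w s =
     r * exp (2 * of_real pi * \<i> * s) / (circlepath a r s - w)\<^sup>2"

lemma continuous_on_circlepath: "continuous_on T (circlepath a r)"
  by (simp add: circlepath) (intro continuous_intros)

lemma continuous_on_cauchy_kernel:
  assumes "continuous_on T g" "continuous_on T h" "\<And>x. x \<in> T \<Longrightarrow> g x \<in> ball a r"
  shows "continuous_on T (\<lambda>x. cauchy_kernel a r (g x) (h x))"
proof -
  have "circlepath a r s \<noteq> w" if "w \<in> ball a r" for s w
  proof -
    \<comment> \<open>The path stays on the boundary circle while \<open>w\<close> lies in the open
      disc, so the denominator of the kernel has no zero.\<close>
    have "dist a (circlepath a r s) = \<bar>r\<bar>" by (simp add: circlepath dist_norm norm_mult)
    then show ?thesis using that by auto
  qed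
  then have ne: "circlepath a r (h x) \<noteq> g x" if "x \<in> T" for x using assms(3)[OF that] by metis
  have c: "continuous_on T (\<lambda>x. circlepath a r (h x))"
    by (rule continuous_on_compose2[OF continuous_on_circlepath assms(2)]) auto
  show ?thesis unfolding cauchy_kernel_def
    by (intro continuous_intros assms(1,2) c) (use ne in auto)
qed

lemma circlepath_in_cball: "r > 0 \<Longrightarrow> circlepath a r s \<in> cball a r"
  by (simp add: circlepath dist_norm norm_mult)

text \<open>Cauchy's formula for the first derivative, on a coordinate line. The centre
  \<open>a\<close> is independent of \<open>z\<close>: one circle serves all points with
  \<open>z c\<close> in the disc, so the integral can be studied as a function of the parameter
  \<open>z\<close>.\<close>

lemma partial_eq_integral:
  assumes V: "open V" "holo V S f" and r: "0 < r" "\<And>t. t \<in> cball a r \<Longrightarrow> z(c := t) \<in> V"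
    and w: "z c \<in> ball a r"
  shows "partial c f z = integral {0..1} (\<lambda>s. f (z(c := circlepath a r s)) * cauchy_kernel a r (z c) s)"
proof -
  define g where "g = (\<lambda>t. f (z(c := t)))"
  have g: "(g has_field_derivative partial c f (z(c := t))) (at t)" if "t \<in> cball a r" for t
    unfolding g_def using holo_has_partial[OF V r(2)[OF that]] .
  have cont: "continuous_on (cball a r) g"
    using g by (meson DERIV_isCont continuous_at_imp_continuous_on)
  have hol: "g holomorphic_on ball a r"
    unfolding holomorphic_on_def
  proof
    fix t assume "t \<in> ball a r"
    then have "g field_differentiable at t"
      using g[of t] unfolding field_differentiable_def by auto
    then show "g field_differentiable at t within ball a r" by (rule field_differentiable_at_within)
  qed
  have "partial c f z = 1 / (2 * of_real pi * \<i>) * contour_integral (circlepath a r) (\<lambda>u. g u / (u - z c)\<^sup>2)"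
    using Cauchy_derivative_integral_circlepath(2)[OF cont hol w]
    unfolding partial_def g_def by (rule DERIV_imp_deriv)
  also have "\<dots> = integral {0..1} (\<lambda>s. 1 / (2 * of_real pi * \<i>) * (g (circlepath a r s) / (circlepath a r s - z c)\<^sup>2
      * (2 * pi * \<i> * r * exp (2 * of_real pi * \<i> * s))))"
    by (simp only: contour_integral_integral vector_derivative_circlepath integral_mult_right)
  also have "\<dots> = integral {0..1} (\<lambda>s. f (z(c := circlepath a r s)) * cauchy_kernel a r (z c) s)"
  proof (rule integral_cong)
    have *: "1 / w * (x / y * (w * u * e)) = x * (u * e / y)" if "w \<noteq> 0" for w x y u e :: complex
      using that by simp
    show "1 / (2 * of_real pi * \<i>) * (g (circlepath a r s) / (circlepath a r s - z c)\<^sup>2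
      * (2 * pi * \<i> * r * exp (2 * of_real pi * \<i> * s))) =
      f (z(c := circlepath a r s)) * cauchy_kernel a r (z c) s" for s
      using *[of "2 * of_real pi * \<i>"] by (simp only: cauchy_kernel_def g_def) simp
  qed
  finally show ?thesis .
qed

text \<open>Provides one circle in direction \<open>c\<close> that stays in \<open>V\<close> when
  started from any point of a box. Having \<open>c\<close> in \<open>K\<close> puts
  \<open>z c\<close> inside that circle.\<close>

lemma nbox_update_in:
  fixes V :: "'c pt set"
  assumes "open V" "z0 \<in> V"
  obtains K r where "finite K" "c \<in> K" "r > 0"
    "\<And>z t. z \<in> nbox K z0 r \<Longrightarrow> t \<in> cball (z0 c) r \<Longrightarrow> z(c := t) \<in> V"
proof -
  obtain K e where K: "finite K" "e > 0" "nbox K z0 e \<subseteq> V"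
    using open_contains_nbox[OF assms] by blast
  \<comment> \<open>The radius is halved because \<open>t\<close> ranges over a closed disc, whereas
    \<open>nbox\<close> is given by a strict inequality.\<close>
  have "z(c := t) \<in> V" if "z \<in> nbox (insert c K) z0 (e/2)" "t \<in> cball (z0 c) (e/2)" for z t
  proof -
    have "dist ((z(c := t)) b) (z0 b) < e" if b: "b \<in> K" for b
    proof (cases "b = c")
      case True
      then show ?thesis using \<open>t \<in> _\<close> K(2) by (simp add: dist_commute)
    next
      case False
      have "dist (z b) (z0 b) < e/2" using \<open>z \<in> nbox _ _ _\<close> b by (simp add: nbox_def)
      then show ?thesis using False K(2) by simp
    qed
    then have "z(c := t) \<in> nbox K z0 e" by (simp add: nbox_def)
    then show ?thesis using K(3) by blast
  qed
  then show thesis using that[of "insert c K" "e/2"] K by auto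
qed

text \<open>Near each point the derivative is an integral over a fixed interval, with an integrand
  jointly continuous in the point and the path parameter.\<close>

lemma continuous_on_partial:
  assumes V: "open V" "holo V S f"
  shows "continuous_on V (partial c f)"
proof -
  have "\<exists>W. open W \<and> z0 \<in> W \<and> continuous_on W (partial c f)" if z0: "z0 \<in> V" for z0
  proof -
  obtain K r where K: "finite K" "c \<in> K" "r > 0"
    "\<And>z t. z \<in> nbox K z0 r \<Longrightarrow> t \<in> cball (z0 c) r \<Longrightarrow> z(c := t) \<in> V"
    using nbox_update_in[OF V(1) z0, of c] by metis
  define W where "W = nbox K z0 r"
  have W: "open W" "z0 \<in> W" using open_nbox nbox_centre K by (auto simp: W_def)
  have wc: "z c \<in> ball (z0 c) r" if "z \<in> W" for z
    using that K(2) by (auto simp: W_def nbox_def dist_commute)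
  have "continuous_on (W \<times> cbox 0 1)
      (\<lambda>(z, s). f (z(c := circlepath (z0 c) r s)) * cauchy_kernel (z0 c) r (z c) s)"
    unfolding case_prod_beta
  proof (intro continuous_on_mult)
    show "continuous_on (W \<times> cbox 0 1) (\<lambda>p. f ((fst p)(c := circlepath (z0 c) r (snd p))))"
    proof (rule continuous_on_compose2[where t = V and g = f])
      show "continuous_on V f" using V(2) by (simp add: holo_def)
      show "continuous_on (W \<times> cbox 0 1) (\<lambda>p. (fst p)(c := circlepath (z0 c) r (snd p)))"
        by (intro continuous_on_fun_upd continuous_on_compose2[OF continuous_on_circlepath] continuous_intros) auto
      show "(\<lambda>p. (fst p)(c := circlepath (z0 c) r (snd p))) ` (W \<times> cbox 0 1) \<subseteq> V"
        using K(4) circlepath_in_cball[OF K(3)] by (auto simp: W_def)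
    qed
    show "continuous_on (W \<times> cbox 0 1) (\<lambda>p. cauchy_kernel (z0 c) r (fst p c) (snd p))"
      by (intro continuous_on_cauchy_kernel continuous_on_product_then_coordinatewise[OF continuous_on_fst]
          continuous_intros) (use wc in auto)
  qed
  from integral_continuous_on_param[OF this]
  have "continuous_on W
    (\<lambda>z. integral {0..1} (\<lambda>s. f (z(c := circlepath (z0 c) r s)) * cauchy_kernel (z0 c) r (z c) s))"
    by simp
  moreover have "partial c f z =
      integral {0..1} (\<lambda>s. f (z(c := circlepath (z0 c) r s)) * cauchy_kernel (z0 c) r (z c) s)" if "z \<in> W" for z
    using that K wc by (intro partial_eq_integral[OF V]) (auto simp: W_def)
  ultimately have "continuous_on W (partial c f)"
    by (simp cong: continuous_on_cong)
  then show ?thesis using W by blast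
  qed
  then obtain W where W: "\<And>z. z \<in> V \<Longrightarrow> open (W z) \<and> z \<in> W z \<and> continuous_on (W z) (partial c f)"
    by metis
  then have "continuous_on (\<Union>z\<in>V. W z) (partial c f)"
    by (intro continuous_on_open_UN) auto
  then show ?thesis by (rule continuous_on_subset) (use W in blast)
qed

text \<open>The Cauchy integral for \<open>partial c f\<close> is differentiated under the integral
  sign; since \<open>b \<noteq> c\<close>, neither the circle nor the kernel involves the coordinate
  \<open>b\<close>. The derivative is recorded as an explicit integral because this is again a
  Cauchy integral, now of \<open>partial b f\<close>, from which the symmetry of second derivatives
  can be read off.\<close>

lemma partial_has_partial_ne:
  assumes V: "open V" "holo V S f" and z: "z \<in> V" and bc: "b \<noteq> c"
  obtains r where "0 < r" "\<And>t. t \<in> cball (z c) r \<Longrightarrow> z(c := t) \<in> V"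
   "((\<lambda>s. partial c f (z(b := s))) has_field_derivative
      integral {0..1} (\<lambda>s. partial b f (z(c := circlepath (z c) r s)) * cauchy_kernel (z c) r (z c) s)) (at (z b))"
proof -
  obtain K r where K: "finite K" "c \<in> K" "r > 0"
    "\<And>y t. y \<in> nbox K z r \<Longrightarrow> t \<in> cball (z c) r \<Longrightarrow> y(c := t) \<in> V"
    using nbox_update_in[OF V(1) z, of c] by metis
  define W where "W = ball (z b) r"
  have W: "z(b := s) \<in> nbox K z r" if "s \<in> W" for s
    using that K(3) by (auto simp: W_def nbox_def dist_commute)
  have in_V: "(z(c := t))(b := s) \<in> V" if "s \<in> W" "t \<in> cball (z c) r" for s t
    using K(4)[OF W[OF that(1)] that(2)] bc by (simp add: fun_upd_twist)
  let ?\<gamma> = "circlepath (z c) r"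
  let ?k = "\<lambda>s. cauchy_kernel (z c) r (z c) s"
  note circ = circlepath_in_cball[OF K(3), of "z c"]
  have ck: "continuous_on T (\<lambda>x. ?k (h x))" if "continuous_on T h" for T :: "'x::topological_space set" and h
    by (intro continuous_on_cauchy_kernel that continuous_intros) (use K(3) in auto)
  have "((\<lambda>s. integral (cbox 0 1) (\<lambda>u. f ((z(c := ?\<gamma> u))(b := s)) * ?k u)) has_field_derivative
      integral (cbox 0 1) (\<lambda>u. partial b f ((z(c := ?\<gamma> u))(b := z b)) * ?k u)) (at (z b) within W)"
  proof (rule leibniz_rule_field_derivative)
    fix s u assume s: "s \<in> W"
    show "((\<lambda>s. f ((z(c := ?\<gamma> u))(b := s)) * ?k u) has_field_derivative
       partial b f ((z(c := ?\<gamma> u))(b := s)) * ?k u) (at s within W)"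
      using holo_has_partial[OF V in_V[OF s circ]]
      by (intro DERIV_cmult_right) (rule has_field_derivative_at_within)
  next
    fix s assume s: "s \<in> W"
    show "(\<lambda>u. f ((z(c := ?\<gamma> u))(b := s)) * ?k u) integrable_on cbox 0 1"
    proof (rule integrable_continuous, rule continuous_on_mult)
      show "continuous_on (cbox 0 1) (\<lambda>u. f ((z(c := ?\<gamma> u))(b := s)))"
      proof (rule continuous_on_compose2[where t = V and g = f])
        show "continuous_on V f" using V(2) by (simp add: holo_def)
        show "continuous_on (cbox 0 1) (\<lambda>u. (z(c := ?\<gamma> u))(b := s))"
          by (intro continuous_on_fun_upd continuous_on_circlepath continuous_intros)
        show "(\<lambda>u. (z(c := ?\<gamma> u))(b := s)) ` cbox 0 1 \<subseteq> V" using in_V[OF s circ] by auto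
      qed
      show "continuous_on (cbox 0 1) ?k" by (rule ck) (rule continuous_on_id)
    qed
  next
    show "continuous_on (W \<times> cbox 0 1) (\<lambda>(s, u). partial b f ((z(c := ?\<gamma> u))(b := s)) * ?k u)"
      unfolding case_prod_beta
    proof (rule continuous_on_mult)
      show "continuous_on (W \<times> cbox 0 1) (\<lambda>p. partial b f ((z(c := ?\<gamma> (snd p)))(b := fst p)))"
      proof (rule continuous_on_compose2[where t = V and g = "partial b f"])
        show "continuous_on V (partial b f)" by (rule continuous_on_partial[OF V])
        show "continuous_on (W \<times> cbox 0 1) (\<lambda>p. (z(c := ?\<gamma> (snd p)))(b := fst p))"
          by (intro continuous_on_fun_upd continuous_on_compose2[OF continuous_on_circlepath] continuous_intros) auto
        show "(\<lambda>p. (z(c := ?\<gamma> (snd p)))(b := fst p)) ` (W \<times> cbox 0 1) \<subseteq> V" using in_V[OF _ circ] by auto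
      qed
      show "continuous_on (W \<times> cbox 0 1) (\<lambda>p. ?k (snd p))" by (rule ck) (intro continuous_intros)
    qed
  qed (use K(3) in \<open>auto simp: W_def\<close>)
  then have D: "((\<lambda>s. integral {0..1} (\<lambda>u. f ((z(c := ?\<gamma> u))(b := s)) * ?k u)) has_field_derivative
      integral {0..1} (\<lambda>u. partial b f (z(c := ?\<gamma> u)) * ?k u)) (at (z b))"
    using bc K(3) at_within_open[of "z b" W] by (simp add: W_def fun_upd_idem)
  have "\<forall>\<^sub>F s in nhds (z b). s \<in> W"
    using K(3) by (intro eventually_nhds_in_open) (auto simp: W_def)
  then have "\<forall>\<^sub>F s in nhds (z b). partial c f (z(b := s)) =
      integral {0..1} (\<lambda>u. f ((z(c := ?\<gamma> u))(b := s)) * ?k u)"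
  proof eventually_elim
    case (elim s)
    have "partial c f (z(b := s)) = integral {0..1} (\<lambda>u. f ((z(b := s))(c := ?\<gamma> u)) *
        cauchy_kernel (z c) r ((z(b := s)) c) u)"
      using K(3,4) W[OF elim] bc by (intro partial_eq_integral[OF V]) auto
    then show ?case using bc by (simp add: fun_upd_twist)
  qed
  from DERIV_cong_ev[OF refl this refl] D
  have "((\<lambda>s. partial c f (z(b := s))) has_field_derivative
      integral {0..1} (\<lambda>s. partial b f (z(c := ?\<gamma> s)) * ?k s)) (at (z b))" by simp
  then show thesis using that K(3,4) nbox_centre[of r z K] by blast
qed

text \<open>In the direction \<open>c\<close> itself this is the one-variable fact that derivatives
  of holomorphic functions are holomorphic; in any other direction it is differentiation under the
  Cauchy integral.\<close>

lemma holo_partial: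
  assumes V: "open V" "holo V S f"
  shows "holo V S (partial c f)"
proof -
  have "(\<lambda>t. partial c f (z(b := t))) field_differentiable (at (z b))" if z: "z \<in> V" for z b
  proof (cases "b = c")
    case True
    define T where "T = {t. z(c := t) \<in> V}"
    have T: "open T" "z c \<in> T" using open_update_vimage[OF V(1)] z by (auto simp: T_def)
    have "(\<lambda>t. f (z(c := t))) holomorphic_on T"
      unfolding holomorphic_on_def
    proof
      fix t assume "t \<in> T"
      then have "(\<lambda>t. f (z(c := t))) field_differentiable at t"
        using holo_has_partial[OF V, of z c t] unfolding field_differentiable_def T_def by blast
      then show "(\<lambda>t. f (z(c := t))) field_differentiable at t within T"
        by (rule field_differentiable_at_within)
    qed
    then have "deriv (\<lambda>t. f (z(c := t))) holomorphic_on T" using T by (intro holomorphic_deriv)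
    then show ?thesis using T True by (simp add: partial_update holomorphic_on_imp_differentiable_at)
  next
    case False
    then show ?thesis using partial_has_partial_ne[OF V z False] unfolding field_differentiable_def by metis
  qed
  then show ?thesis
    unfolding holo_def using depends_only_partial[OF V(1)] V(2) continuous_on_partial[OF V] by (auto simp: holo_def)
qed

lemma partial_commute:
  assumes V: "open V" "holo V S f" and z: "z \<in> V"
  shows "partial b (partial c f) z = partial c (partial b f) z"
proof (cases "b = c")
  case False
  obtain r where r: "0 < r" "\<And>t. t \<in> cball (z c) r \<Longrightarrow> z(c := t) \<in> V"
   and D: "((\<lambda>s. partial c f (z(b := s))) has_field_derivative
      integral {0..1} (\<lambda>s. partial b f (z(c := circlepath (z c) r s)) * cauchy_kernel (z c) r (z c) s)) (at (z b))"
    using partial_has_partial_ne[OF V z False] by metis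
  have "partial b (partial c f) z =
      integral {0..1} (\<lambda>s. partial b f (z(c := circlepath (z c) r s)) * cauchy_kernel (z c) r (z c) s)"
    using DERIV_imp_deriv[OF D] by (simp add: partial_def)
  also have "\<dots> = partial c (partial b f) z"
    using r by (intro partial_eq_integral[OF V(1) holo_partial[OF V], symmetric]) auto
  finally show ?thesis .
qed simp

section \<open>Functions regular at a point\<close>

lemma holo_cong:
  assumes "open V" "holo V S f" "\<And>y. y \<in> V \<Longrightarrow> f y = g y"
  shows "holo V S g"
  unfolding holo_def
proof (intro conjI ballI)
  show "depends_only V S g"
    using assms(2,3) unfolding holo_def depends_only_def by metis
  show "continuous_on V g"
    using assms(2,3) continuous_on_cong[of V V f g] by (simp add: holo_def)
  fix z c assume z: "z \<in> V" "c \<in> S"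
  have "\<forall>\<^sub>F t in nhds (z c). f (z(c := t)) = g (z(c := t))"
    by (rule eventually_mono[OF eventually_update_in[OF assms(1) z(1)]]) (rule assms(3))
  from DERIV_cong_ev[OF refl this refl] holo_has_partial_at[OF assms(1,2) z(1), of c]
  show "(\<lambda>t. g (z(c := t))) field_differentiable at (z c)"
    unfolding field_differentiable_def by blast
qed

lemma regularI: "open V \<Longrightarrow> z \<in> V \<Longrightarrow> finite S \<Longrightarrow> holo V S f \<Longrightarrow> regular f z"
  unfolding regular_def by blast

lemma regularE:
  assumes "regular f z"
  obtains V S where "open V" "z \<in> V" "finite S" "holo V S f"
  using assms unfolding regular_def by blast

lemma open_regular: "open {z. regular f z}"
proof (subst open_subopen, safe)
  fix z assume "regular f z"
  then obtain V S where V: "open V" "z \<in> V" "finite S" "holo V S f" by (rule regularE)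
  then have "V \<subseteq> {z. regular f z}" using regularI[of V _ S f] by auto
  then show "\<exists>T. open T \<and> z \<in> T \<and> T \<subseteq> {z. regular f z}" using V by blast
qed

lemma regular_cong:
  assumes "open V" "z \<in> V" "\<And>y. y \<in> V \<Longrightarrow> f y = g y" "regular f z"
  shows "regular g z"
proof -
  obtain W S where W: "open W" "z \<in> W" "finite S" "holo W S f" using assms(4) by (rule regularE)
  have "holo (V \<inter> W) S f" by (rule holo_mono[OF W(1,4) Int_lower2 order_refl])
  then have "holo (V \<inter> W) S g"
    by (rule holo_cong[OF open_Int[OF assms(1) W(1)]]) (rule assms(3)[OF IntD1])
  then show ?thesis by (rule regularI[OF open_Int[OF assms(1) W(1)] IntI[OF assms(2) W(2)] W(3)])
qed

lemma regular_common:
  assumes "regular f z" "regular g z"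
  obtains V S where "open V" "z \<in> V" "finite S" "holo V S f" "holo V S g"
proof -
  obtain V S where V: "open V" "z \<in> V" "finite S" "holo V S f" using assms(1) by (rule regularE)
  obtain W T where W: "open W" "z \<in> W" "finite T" "holo W T g" using assms(2) by (rule regularE)
  show thesis
    using that[of "V \<inter> W" "S \<union> T"] V W holo_mono[OF V(1,4), of "V \<inter> W" "S \<union> T"]
      holo_mono[OF W(1,4), of "V \<inter> W" "S \<union> T"] by auto
qed

lemma regular_const: "regular (\<lambda>_. a) z"
  by (intro regularI[of UNIV _ "{}"]) (auto simp: holo_def depends_only_def)

lemma regular_coord: "regular (\<lambda>z. z c) z"
  by (intro regularI[of UNIV _ "{c}"]) (auto simp: holo_def depends_only_def)

lemma regular_add:
  assumes "regular f z" "regular g z"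
  shows "regular (\<lambda>y. f y + g y) z"
proof -
  obtain V S where V: "open V" "z \<in> V" "finite S" "holo V S f" "holo V S g"
    using regular_common[OF assms] .
  have "holo V S (\<lambda>y. f y + g y)"
    unfolding holo_def
  proof (intro conjI ballI)
    show "depends_only V S (\<lambda>y. f y + g y)"
      using V(4,5) unfolding holo_def depends_only_def by metis
    show "continuous_on V (\<lambda>y. f y + g y)"
      using V(4,5) by (auto simp: holo_def intro: continuous_on_add)
    show "(\<lambda>t. f (y(c := t)) + g (y(c := t))) field_differentiable at (y c)" if "y \<in> V" "c \<in> S" for y c
      using V(4,5) that by (auto simp: holo_def intro: field_differentiable_add)
  qed
  then show ?thesis using V by (intro regularI)
qed

lemma regular_mult:
  assumes "regular f z" "regular g z"
  shows "regular (\<lambda>y. f y * g y) z"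
proof -
  obtain V S where V: "open V" "z \<in> V" "finite S" "holo V S f" "holo V S g"
    using regular_common[OF assms] .
  have "holo V S (\<lambda>y. f y * g y)"
    unfolding holo_def
  proof (intro conjI ballI)
    show "depends_only V S (\<lambda>y. f y * g y)"
      using V(4,5) unfolding holo_def depends_only_def by metis
    show "continuous_on V (\<lambda>y. f y * g y)"
      using V(4,5) by (auto simp: holo_def intro: continuous_on_mult)
    show "(\<lambda>t. f (y(c := t)) * g (y(c := t))) field_differentiable at (y c)" if "y \<in> V" "c \<in> S" for y c
      using V(4,5) that by (auto simp: holo_def intro: field_differentiable_mult)
  qed
  then show ?thesis using V by (intro regularI)
qed

lemma regular_sum: "(\<And>i. i \<in> I \<Longrightarrow> regular (f i) z) \<Longrightarrow> regular (\<lambda>y. \<Sum>i\<in>I. f i y) z"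
  by (induction I rule: infinite_finite_induct) (auto intro: regular_const regular_add)

lemma regular_partial: "regular f z \<Longrightarrow> regular (partial c f) z"
  by (erule regularE) (rule regularI, assumption+, rule holo_partial)

lemma regular_has_partial:
  "regular f z \<Longrightarrow> ((\<lambda>t. f (z(c := t))) has_field_derivative partial c f z) (at (z c))"
  by (erule regularE) (rule holo_has_partial_at)

lemma holo_partial_0: "open V \<Longrightarrow> holo V S f \<Longrightarrow> z \<in> V \<Longrightarrow> c \<notin> S \<Longrightarrow> partial c f z = 0"
  by (rule depends_only_partial_0[of V S]) (auto simp: holo_def)

lemma partial_add:
  assumes "regular f z" "regular g z"
  shows "partial c (\<lambda>y. f y + g y) z = partial c f z + partial c g z"
  unfolding partial_def[of c "\<lambda>y. f y + g y"]
  by (rule DERIV_imp_deriv) (intro DERIV_add regular_has_partial assms)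

lemma partial_mult:
  assumes "regular f z" "regular g z"
  shows "partial c (\<lambda>y. f y * g y) z = partial c f z * g z + partial c g z * f z"
  unfolding partial_def[of c "\<lambda>y. f y * g y"]
  by (rule DERIV_imp_deriv)
     (use DERIV_mult[OF regular_has_partial[OF assms(1), of c] regular_has_partial[OF assms(2), of c]] in simp)

lemma partial_const: "partial c (\<lambda>_. a) z = 0"
  by (simp add: partial_def)

lemma partial_coord: "partial c (\<lambda>z. z b) z = (if b = c then 1 else 0)"
  by (simp add: partial_def)

section \<open>Differentials\<close>

lemma differential_eq_sum:
  assumes "finite S" "\<And>c. c \<notin> S \<Longrightarrow> partial c f z = 0"
  shows "differential f z v = (\<Sum>c\<in>S. partial c f z * v c)"
  unfolding differential_def using assms by (intro Sum_any.expand_superset) auto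

lemma differential_cong:
  assumes "open V" "z \<in> V" "\<And>y. y \<in> V \<Longrightarrow> f y = g y"
  shows "differential f z v = differential g z v"
  unfolding differential_def by (simp only: partial_cong[OF assms])

text \<open>A finite set supporting the partial derivatives of both functions also supports those of
  their sum and product, which reduces the rules below to a termwise comparison.
  \<open>Sum_any\<close> is 0 on infinite supports, so such a set must be exhibited.\<close>

lemma differential_common:
  assumes "regular f z" "regular g z"
  obtains S where "finite S" "\<And>v. differential f z v = (\<Sum>c\<in>S. partial c f z * v c)"
    "\<And>v. differential g z v = (\<Sum>c\<in>S. partial c g z * v c)"
    "\<And>c. c \<notin> S \<Longrightarrow> partial c f z = 0" "\<And>c. c \<notin> S \<Longrightarrow> partial c g z = 0"
proof -
  obtain V S where V: "open V" "z \<in> V" "finite S" "holo V S f" "holo V S g"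
    using regular_common[OF assms] .
  show thesis
    using that[OF V(3) differential_eq_sum[OF V(3)] differential_eq_sum[OF V(3)]]
      holo_partial_0[OF V(1,4,2)] holo_partial_0[OF V(1,5,2)] by simp
qed

lemma differential_add:
  assumes "regular f z" "regular g z"
  shows "differential (\<lambda>y. f y + g y) z v = differential f z v + differential g z v"
proof -
  obtain S where S: "finite S" "\<And>v. differential f z v = (\<Sum>c\<in>S. partial c f z * v c)"
    "\<And>v. differential g z v = (\<Sum>c\<in>S. partial c g z * v c)"
    "\<And>c. c \<notin> S \<Longrightarrow> partial c f z = 0" "\<And>c. c \<notin> S \<Longrightarrow> partial c g z = 0"
    using differential_common[OF assms] by blast
  have "differential (\<lambda>y. f y + g y) z v = (\<Sum>c\<in>S. partial c (\<lambda>y. f y + g y) z * v c)"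
    using S by (intro differential_eq_sum) (simp_all add: partial_add[OF assms])
  then show ?thesis by (simp add: S(2,3) partial_add[OF assms] sum.distrib ring_distribs)
qed

lemma differential_mult:
  assumes "regular f z" "regular g z"
  shows "differential (\<lambda>y. f y * g y) z v = differential f z v * g z + f z * differential g z v"
proof -
  obtain S where S: "finite S" "\<And>v. differential f z v = (\<Sum>c\<in>S. partial c f z * v c)"
    "\<And>v. differential g z v = (\<Sum>c\<in>S. partial c g z * v c)"
    "\<And>c. c \<notin> S \<Longrightarrow> partial c f z = 0" "\<And>c. c \<notin> S \<Longrightarrow> partial c g z = 0"
    using differential_common[OF assms] by blast
  have "differential (\<lambda>y. f y * g y) z v = (\<Sum>c\<in>S. partial c (\<lambda>y. f y * g y) z * v c)"
    using S by (intro differential_eq_sum) (simp_all add: partial_mult[OF assms])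
  then show ?thesis
    by (simp add: S(2,3) partial_mult[OF assms] sum.distrib ring_distribs sum_distrib_left sum_distrib_right ac_simps)
qed

lemma differential_const: "differential (\<lambda>_. a) z v = 0"
  by (simp add: differential_def partial_const)

lemma differential_coord: "differential (\<lambda>z. z c) z v = v c"
  using differential_eq_sum[of "{c}" "\<lambda>z. z c" z v] by (auto simp: partial_coord)

lemma differential_sum:
  "(\<And>i. i \<in> I \<Longrightarrow> regular (f i) z) \<Longrightarrow>
    differential (\<lambda>y. \<Sum>i\<in>I. f i y) z v = (\<Sum>i\<in>I. differential (f i) z v)"
proof (induction I rule: infinite_finite_induct)
  case (insert i I)
  then show ?case
    by (simp add: differential_add[of "f i" z "\<lambda>y. \<Sum>i\<in>I. f i y"] regular_sum)
qed (simp_all add: differential_const)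

section \<open>Derivations along vector fields\<close>

lemma lie_cong:
  assumes "open V" "z \<in> V" "\<And>y. y \<in> V \<Longrightarrow> f y = g y"
  shows "lie v f z = lie v g z"
  unfolding lie_def by (rule differential_cong[OF assms])

lemma lie_mult:
  "regular f z \<Longrightarrow> regular g z \<Longrightarrow> lie v (\<lambda>y. f y * g y) z = lie v f z * g z + f z * lie v g z"
  unfolding lie_def by (rule differential_mult)

lemma lie_sum:
  "(\<And>i. i \<in> I \<Longrightarrow> regular (f i) z) \<Longrightarrow> lie v (\<lambda>y. \<Sum>i\<in>I. f i y) z = (\<Sum>i\<in>I. lie v (f i) z)"
  unfolding lie_def by (rule differential_sum)

lemma lie_const: "lie v (\<lambda>_. a) z = 0"
  unfolding lie_def by (rule differential_const)

lemma lie_coord: "lie v (\<lambda>z. z c) z = v c z"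
  unfolding lie_def by (rule differential_coord)

lemma lie_eq_sum:
  assumes "open V" "holo V S f" "finite S" "z \<in> V"
  shows "lie v f z = (\<Sum>c\<in>S. partial c f z * v c z)"
  unfolding lie_def using assms(3) holo_partial_0[OF assms(1,2,4)] by (rule differential_eq_sum)

text \<open>Near \<open>z\<close> only the components \<open>v c\<close> with
  \<open>c \<in> S\<close> enter. Regularity is asked for these alone, since the infinitely many
  components of a field may fail to be regular on a common dense open set.\<close>

lemma regular_lie:
  assumes "open V" "holo V S f" "finite S" "z \<in> V" "\<And>c. c \<in> S \<Longrightarrow> regular (v c) z"
  shows "regular (lie v f) z"
proof (rule regular_cong[of V])
  show "(\<Sum>c\<in>S. partial c f y * v c y) = lie v f y" if "y \<in> V" for y
    using lie_eq_sum[OF assms(1-3) that] by simp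
  show "regular (\<lambda>y. \<Sum>c\<in>S. partial c f y * v c y) z"
    using assms by (intro regular_sum regular_mult regular_partial) (auto intro: regularI)
qed (use assms in auto)

text \<open>In the commutator the second derivatives of \<open>f\<close> cancel by symmetry; what
  remains is the sum of \<open>partial c f\<close> times the commutator on the coordinate
  \<open>c\<close>, which vanishes by \<open>comm\<close>.\<close>

lemma lie_commute:
  assumes V: "open V" "holo V S f" "finite S" "z \<in> V"
    and v: "\<And>c. c \<in> S \<Longrightarrow> regular (v c) z" and w: "\<And>c. c \<in> S \<Longrightarrow> regular (w c) z"
    and comm: "\<And>c. c \<in> S \<Longrightarrow> lie v (w c) z = lie w (v c) z"
  shows "lie v (lie w f) z = lie w (lie v f) z"
proof -
  have reg: "regular (partial c f) z" for c
    using V by (intro regular_partial regularI)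
  \<comment> \<open>Stated for fresh fields, shadowing the fixed ones, so that it expands the
    composition in both orders.\<close>
  have expand: "lie v (lie w f) z = (\<Sum>c\<in>S. \<Sum>b\<in>S. partial b (partial c f) z * v b z * w c z) +
      (\<Sum>c\<in>S. partial c f z * lie v (w c) z)"
    if w: "\<And>c. c \<in> S \<Longrightarrow> regular (w c) z" for v w :: "'a \<Rightarrow> 'a pfun"
  proof -
    have "lie v (lie w f) z = lie v (\<lambda>y. \<Sum>c\<in>S. partial c f y * w c y) z"
      using lie_eq_sum[OF V(1-3)] by (intro lie_cong[OF V(1,4)])
    also have "\<dots> = (\<Sum>c\<in>S. lie v (\<lambda>y. partial c f y * w c y) z)"
      by (intro lie_sum regular_mult reg w)
    also have "\<dots> = (\<Sum>c\<in>S. lie v (partial c f) z * w c z + partial c f z * lie v (w c) z)"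
      by (intro sum.cong lie_mult reg w refl)
    also have "\<dots> = (\<Sum>c\<in>S. (\<Sum>b\<in>S. partial b (partial c f) z * v b z) * w c z + partial c f z * lie v (w c) z)"
      using lie_eq_sum[OF V(1) holo_partial[OF V(1,2)] V(3,4)] by simp
    finally show ?thesis by (simp add: sum.distrib sum_distrib_right)
  qed
  have "(\<Sum>c\<in>S. \<Sum>b\<in>S. partial b (partial c f) z * v b z * w c z) =
      (\<Sum>c\<in>S. \<Sum>b\<in>S. partial b (partial c f) z * w b z * v c z)"
    by (subst sum.swap) (simp add: partial_commute[OF V(1,2,4)] ac_simps)
  then show ?thesis by (simp add: expand[OF v] expand[OF w] comm)
qed

section \<open>Curves and the chain rule\<close>

lemma eventually_curve_in:
  fixes \<phi> :: "complex \<Rightarrow> 'c pt"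
  assumes "open V" "\<phi> 0 \<in> V" "\<And>c. isCont (\<lambda>t. \<phi> t c) 0"
  shows "\<forall>\<^sub>F t in nhds 0. \<phi> t \<in> V"
proof -
  obtain K e where K: "finite K" "e > 0" "nbox K (\<phi> 0) e \<subseteq> V"
    using open_contains_nbox[OF assms(1,2)] by blast
  have "\<forall>\<^sub>F t in nhds 0. dist (\<phi> t c) (\<phi> 0 c) < e" for c
    using assms(3)[of c] K(2) unfolding isCont_def eventually_nhds_conv_at by (auto dest: tendstoD)
  then have "\<forall>\<^sub>F t in nhds 0. \<forall>c\<in>K. dist (\<phi> t c) (\<phi> 0 c) < e"
    using K(1) by (intro eventually_ball_finite) auto
  then show ?thesis by eventually_elim (use K(3) in \<open>auto simp: nbox_def\<close>)
qed

text \<open>The curve is differentiable only at 0 and only coordinate by coordinate. The increment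
  of \<open>f\<close> is therefore written as a telescoping sum in which one coordinate of
  \<open>S\<close> changes at a time, and each term is controlled by the continuity of one partial
  derivative.\<close>

lemma holo_chain_rule:
  fixes \<phi> :: "complex \<Rightarrow> 'c pt"
  assumes V: "open V" "holo V S f" "finite S" "z \<in> V"
    and \<phi>0: "\<phi> 0 = z" and \<phi>: "\<And>c. ((\<lambda>t. \<phi> t c) has_field_derivative v c) (at 0)"
  shows "((\<lambda>t. f (\<phi> t)) has_field_derivative differential f z v) (at 0)"
proof -
  \<comment> \<open>The coordinates in \<open>K\<close> follow the curve, the others stay at
    \<open>z\<close>; enlarging \<open>K\<close> up to \<open>S\<close> one element at a time gives
    the telescoping sum.\<close>
  define mix where "mix = (\<lambda>K t c. if c \<in> K then \<phi> t c else z c)"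
  have o0: "mix K 0 = z" for K by (auto simp: mix_def \<phi>0)
  have contphi: "isCont (\<lambda>t. \<phi> t c) 0" for c using \<phi> by (rule DERIV_isCont)
  have conto: "isCont (\<lambda>t. mix K t c) 0" for K c
    using contphi[of c] by (cases "c \<in> K") (simp_all add: mix_def)
  have step: "((\<lambda>t. f (mix (insert c K) t) - f (mix K t)) has_field_derivative partial c f z * v c) (at 0)"
    if "c \<notin> K" for c K
  proof -
    \<comment> \<open>A difference quotient in the coordinate \<open>c\<close>. It is given its
      limit as value where \<open>\<phi> t c = z c\<close>, because the curve may return to
      \<open>z c\<close> for \<open>t\<close> arbitrarily close to 0.\<close>
    define q where "q = (\<lambda>t. if \<phi> t c = z c then partial c f z
      else (f (mix (insert c K) t) - f (mix K t)) / (\<phi> t c - z c))"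
    have ins: "mix (insert c K) t = (mix K t)(c := \<phi> t c)" for t by (auto simp: mix_def)
    have idem: "mix K t = (mix K t)(c := z c)" for t using that by (auto simp: mix_def)
    have R: "f (mix (insert c K) t) - f (mix K t) = q t * (\<phi> t c - z c)" for t
      using ins[of t] idem[of t] by (auto simp: q_def)
    have "(q \<longlongrightarrow> partial c f z) (at 0)"
    proof (rule tendstoI)
      fix e :: real assume e: "e > 0"
      define W where "W = {y\<in>V. dist (partial c f y) (partial c f z) < e/2}"
      have "open ((\<lambda>y. partial c f y) -` ball (partial c f z) (e/2) \<inter> V)"
        using continuous_on_open_vimage[OF V(1)] continuous_on_partial[OF V(1,2)] by blast
      moreover have "(\<lambda>y. partial c f y) -` ball (partial c f z) (e/2) \<inter> V = W"
        by (auto simp: W_def dist_commute)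
      ultimately have "open W" by simp
      moreover have "z \<in> W" using e V(4) by (simp add: W_def)
      ultimately obtain L r where L: "finite L" "c \<in> L" "r > 0"
        "\<And>y t. y \<in> nbox L z r \<Longrightarrow> t \<in> cball (z c) r \<Longrightarrow> y(c := t) \<in> W"
        using nbox_update_in[of W z c] by metis
      have "\<forall>\<^sub>F t in nhds 0. mix K t \<in> nbox L z r"
        using open_nbox[OF L(1)] nbox_centre[OF L(3)] conto by (intro eventually_curve_in) (auto simp: o0)
      moreover have "\<forall>\<^sub>F t in nhds 0. \<phi> t \<in> nbox L z r"
        using open_nbox[OF L(1)] nbox_centre[OF L(3)] contphi by (intro eventually_curve_in) (auto simp: \<phi>0)
      ultimately have "\<forall>\<^sub>F t in nhds 0. dist (q t) (partial c f z) < e"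
      proof eventually_elim
        case (elim t)
        let ?y = "\<lambda>s. (mix K t)(c := s)"
        have y: "?y s \<in> W" if "s \<in> cball (z c) r" for s using L(4)[OF elim(1) that] .
        \<comment> \<open>A mean value estimate for \<open>f\<close> minus its linear part on the
          convex disc. The bound \<open>e/2\<close> makes the strict inequality with
          \<open>e\<close> available at the end.\<close>
        have "norm ((f (?y (\<phi> t c)) - partial c f z * \<phi> t c) - (f (?y (z c)) - partial c f z * z c))
            \<le> e/2 * norm (\<phi> t c - z c)"
        proof (rule field_differentiable_bound[where S = "cball (z c) r" and
              f' = "\<lambda>s. partial c f (?y s) - partial c f z" and f = "\<lambda>s. f (?y s) - partial c f z * s"])
          fix s assume s: "s \<in> cball (z c) r"
          have "((\<lambda>s. f (?y s)) has_field_derivative partial c f (?y s)) (at s)"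
            using y[OF s] by (intro holo_has_partial[OF V(1,2)]) (auto simp: W_def)
          then have "((\<lambda>s. f (?y s) - partial c f z * s) has_field_derivative partial c f (?y s) - partial c f z) (at s)"
            by (auto intro!: derivative_eq_intros)
          then show "((\<lambda>s. f (?y s) - partial c f z * s) has_field_derivative partial c f (?y s) - partial c f z)
              (at s within cball (z c) r)"
            by (rule has_field_derivative_at_within)
          show "norm (partial c f (?y s) - partial c f z) \<le> e/2"
            using y[OF s] by (simp add: W_def dist_norm)
        next
          show "\<phi> t c \<in> cball (z c) r" using elim(2) L(2) by (auto simp: nbox_def dist_commute)
        qed (use L(3) in auto)
        then have *: "norm (q t * (\<phi> t c - z c) - partial c f z * (\<phi> t c - z c)) \<le> e/2 * norm (\<phi> t c - z c)"
          unfolding R[symmetric] using ins[of t] idem[of t] by (simp add: algebra_simps)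
        show ?case
        proof (cases "\<phi> t c = z c")
          case True
          then show ?thesis using e by (simp add: q_def)
        next
          case False
          have "norm (q t - partial c f z) * norm (\<phi> t c - z c) \<le> e/2 * norm (\<phi> t c - z c)"
            using * by (simp add: left_diff_distrib[symmetric] norm_mult)
          then have "norm (q t - partial c f z) \<le> e/2" using False by simp
          then show ?thesis using e by (simp add: dist_norm)
        qed
      qed
      then show "\<forall>\<^sub>F t in at 0. dist (q t) (partial c f z) < e"
        by (auto simp: eventually_nhds_conv_at)
    qed
    moreover have "((\<lambda>t. (\<phi> t c - z c) / t) \<longlongrightarrow> v c) (at 0)"
      using \<phi>[of c] by (simp add: has_field_derivative_iff \<phi>0)
    ultimately have "((\<lambda>t. q t * ((\<phi> t c - z c) / t)) \<longlongrightarrow> partial c f z * v c) (at 0)"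
      by (rule tendsto_mult)
    then show ?thesis by (simp add: has_field_derivative_iff \<phi>0 R)
  qed
  have "((\<lambda>t. f (mix K t)) has_field_derivative (\<Sum>c\<in>K. partial c f z * v c)) (at 0)" if "finite K" for K
    using that
  proof (induction K)
    case empty
    then show ?case by (simp add: mix_def)
  next
    case (insert c K)
    from DERIV_add[OF insert.IH step[OF insert.hyps(2)]] insert.hyps show ?case
      by (simp add: add.commute)
  qed
  from this[OF V(3)] have D: "((\<lambda>t. f (mix S t)) has_field_derivative differential f z v) (at 0)"
    using V holo_partial_0[OF V(1,2,4)] by (subst differential_eq_sum[of S]) auto
  have "\<forall>\<^sub>F t in nhds 0. \<phi> t \<in> V"
    using V \<phi>0 contphi by (intro eventually_curve_in) auto
  \<comment> \<open>\<open>f\<close> is determined by the coordinates in \<open>S\<close> only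
    inside \<open>V\<close>, so both curves must be known to stay there before their values are
    identified.\<close>
  moreover have "\<forall>\<^sub>F t in nhds 0. mix S t \<in> V"
    using V o0 conto by (intro eventually_curve_in) auto
  ultimately have "\<forall>\<^sub>F t in nhds 0. f (mix S t) = f (\<phi> t)"
  proof eventually_elim
    case (elim t)
    have "depends_only V S f" using V(2) by (simp add: holo_def)
    moreover have "\<forall>c\<in>S. mix S t c = \<phi> t c" by (simp add: mix_def)
    ultimately show ?case using elim unfolding depends_only_def by blast
  qed
  from DERIV_cong_ev[OF refl this refl, THEN iffD1, OF D] show ?thesis .
qed

text \<open>Along a curve in \<open>S\<close> with velocity \<open>v\<close> both functions coincide
  near 0, and the chain rule computes the derivative of each. Individual partial derivatives of
  \<open>f\<close> and \<open>g\<close> may well differ.\<close>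

lemma differential_eq_tangent:
  assumes v: "v \<in> tangent_space S z" and z: "open U" "z \<in> U"
    and fg: "regular f z" "regular g z" "\<And>y. y \<in> S \<inter> U \<Longrightarrow> f y = g y"
  shows "differential f z v = differential g z v"
proof -
  obtain \<phi> where \<phi>: "\<phi> 0 = z" "\<forall>\<^sub>F t in nhds 0. \<phi> t \<in> S"
    "\<And>c. ((\<lambda>t. \<phi> t c) has_field_derivative v c) (at 0)"
    using v unfolding tangent_space_def by blast
  have D: "((\<lambda>t. f (\<phi> t)) has_field_derivative differential f z v) (at 0)" if "regular f z" for f
    using that by (rule regularE) (rule holo_chain_rule[OF _ _ _ _ \<phi>(1,3)])
  have "\<forall>\<^sub>F t in nhds 0. \<phi> t \<in> U"
    using z \<phi> by (intro eventually_curve_in DERIV_isCont[OF \<phi>(3)]) auto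
  with \<phi>(2) have "\<forall>\<^sub>F t in nhds 0. f (\<phi> t) = g (\<phi> t)"
    by eventually_elim (use fg(3) in auto)
  from DERIV_cong_ev[OF refl this refl, THEN iffD1, OF D[OF fg(1)]] D[OF fg(2)]
  show ?thesis by (rule DERIV_unique)
qed

section \<open>Generic properties\<close>

text \<open>The working form of density: inside any open set meeting \<open>S\<close> one can shrink
  to a smaller one on which \<open>P\<close> holds throughout. Conversely, the union of all open
  sets on which \<open>P\<close> holds throughout is dense, since otherwise one could shrink inside
  the complement of its closure.\<close>

lemma generically_iff:
  "generically S P \<longleftrightarrow>
    (\<forall>W. open W \<longrightarrow> S \<inter> W \<noteq> {} \<longrightarrow> (\<exists>V. open V \<and> V \<subseteq> W \<and> S \<inter> V \<noteq> {} \<and> (\<forall>z\<in>S \<inter> V. P z)))"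
    (is "?L = ?R")
proof
  assume ?L
  then obtain U where U: "open U" "S \<subseteq> closure (S \<inter> U)" "\<forall>z\<in>S \<inter> U. P z"
    unfolding generically_def by blast
  show ?R
  proof (intro allI impI)
    fix W assume W: "open W" "S \<inter> W \<noteq> {}"
    then have "W \<inter> closure (S \<inter> U) \<noteq> {}" using U(2) by blast
    then have "W \<inter> (S \<inter> U) \<noteq> {}" using open_Int_closure_eq_empty[OF W(1)] by metis
    then show "\<exists>V. open V \<and> V \<subseteq> W \<and> S \<inter> V \<noteq> {} \<and> (\<forall>z\<in>S \<inter> V. P z)"
      using U W by (intro exI[of _ "W \<inter> U"]) auto
  qed
next
  assume R: ?R
  define U where "U = \<Union>{V. open V \<and> (\<forall>z\<in>S \<inter> V. P z)}"
  have "z \<in> closure (S \<inter> U)" if z: "z \<in> S" for z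
  proof (rule ccontr)
    assume "z \<notin> closure (S \<inter> U)"
    then have "S \<inter> - closure (S \<inter> U) \<noteq> {}" using z by blast
    moreover have "open (- closure (S \<inter> U))" by (rule open_Compl[OF closed_closure])
    ultimately obtain V where V: "open V" "V \<subseteq> - closure (S \<inter> U)" "S \<inter> V \<noteq> {}" "\<forall>z\<in>S \<inter> V. P z"
      using R by meson
    then have "V \<subseteq> U" unfolding U_def by blast
    then show False using V closure_subset[of "S \<inter> U"] by blast
  qed
  moreover have "open U" unfolding U_def by (intro open_Union) simp
  moreover have "\<forall>z\<in>S \<inter> U. P z" unfolding U_def by blast
  ultimately show ?L unfolding generically_def by blast
qed

lemma genericallyE:
  assumes "generically S P" "open W" "S \<inter> W \<noteq> {}"
  obtains V where "open V" "V \<subseteq> W" "S \<inter> V \<noteq> {}" "\<And>z. z \<in> S \<Longrightarrow> z \<in> V \<Longrightarrow> P z"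
  using assms unfolding generically_iff by (meson IntI)

lemma generically_always: "(\<And>z. z \<in> S \<Longrightarrow> P z) \<Longrightarrow> generically S P"
  unfolding generically_iff by blast

lemma generically_mono:
  assumes "generically S P" "\<And>z. z \<in> S \<Longrightarrow> P z \<Longrightarrow> Q z"
  shows "generically S Q"
  using assms unfolding generically_def by blast

text \<open>Lets a proof fix a generic point and then work in a neighbourhood adapted to it, for
  instance one on which a function depends on a particular finite set of coordinates.\<close>

lemma generically_local:
  assumes "generically S Q" "\<And>z. z \<in> S \<Longrightarrow> Q z \<Longrightarrow> \<exists>U. open U \<and> z \<in> U \<and> generically (S \<inter> U) P"
  shows "generically S P"
  unfolding generically_iff
proof (intro allI impI)
  fix W :: "'a pt set" assume W: "open W" "S \<inter> W \<noteq> {}"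
  obtain V where V: "open V" "V \<subseteq> W" "S \<inter> V \<noteq> {}" "\<And>z. z \<in> S \<Longrightarrow> z \<in> V \<Longrightarrow> Q z"
    using genericallyE[OF assms(1) W] by metis
  then obtain z where z: "z \<in> S" "z \<in> V" by blast
  from assms(2)[OF z(1) V(4)[OF z]] obtain U where U: "open U" "z \<in> U" "generically (S \<inter> U) P" by blast
  have "open (V \<inter> U)" "(S \<inter> U) \<inter> (V \<inter> U) \<noteq> {}" using U V z by auto
  from genericallyE[OF U(3) this] obtain V' where V': "open V'" "V' \<subseteq> V \<inter> U" "S \<inter> U \<inter> V' \<noteq> {}"
    "\<And>z. z \<in> S \<inter> U \<Longrightarrow> z \<in> V' \<Longrightarrow> P z" by metis
  show "\<exists>V. open V \<and> V \<subseteq> W \<and> S \<inter> V \<noteq> {} \<and> (\<forall>z\<in>S \<inter> V. P z)"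
    using V' V(2) by (intro exI[of _ V']) auto
qed

lemma generically_Int:
  assumes "generically S P" "open U"
  shows "generically (S \<inter> U) P"
  unfolding generically_iff
proof (intro allI impI)
  fix W assume W: "open W" "S \<inter> U \<inter> W \<noteq> {}"
  then have "open (U \<inter> W)" "S \<inter> (U \<inter> W) \<noteq> {}" using assms(2) by auto
  from genericallyE[OF assms(1) this] obtain V where "open V" "V \<subseteq> U \<inter> W" "S \<inter> V \<noteq> {}"
    "\<And>z. z \<in> S \<Longrightarrow> z \<in> V \<Longrightarrow> P z" by metis
  then show "\<exists>V. open V \<and> V \<subseteq> W \<and> S \<inter> U \<inter> V \<noteq> {} \<and> (\<forall>z\<in>S \<inter> U \<inter> V. P z)"
    by (intro exI[of _ V]) auto
qed

text \<open>Density of the second set survives restriction to the open set that witnesses the first,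
  and locality then gives the intersection.\<close>

lemma generically_conj:
  assumes "generically S P" "generically S Q"
  shows "generically S (\<lambda>z. P z \<and> Q z)"
proof -
  obtain U where U: "open U" "S \<subseteq> closure (S \<inter> U)" "\<forall>z\<in>S \<inter> U. P z"
    using assms(1) unfolding generically_def by blast
  have "generically S (\<lambda>z. z \<in> U)" unfolding generically_def using U by blast
  then show ?thesis
  proof (rule generically_local)
    fix z assume "z \<in> U"
    moreover have "generically (S \<inter> U) (\<lambda>z. P z \<and> Q z)"
      by (rule generically_mono[OF generically_Int[OF assms(2) U(1)]]) (use U in auto)
    ultimately show "\<exists>U. open U \<and> z \<in> U \<and> generically (S \<inter> U) (\<lambda>z. P z \<and> Q z)"
      using U(1) by blast
  qed
qed

lemma generically_ball:
  "finite I \<Longrightarrow> (\<And>i. i \<in> I \<Longrightarrow> generically S (P i)) \<Longrightarrow> generically S (\<lambda>z. \<forall>i\<in>I. P i z)"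
proof (induction I rule: finite_induct)
  case empty
  then show ?case by (simp add: generically_always)
next
  case (insert i I)
  then show ?case using generically_conj[of S "P i" "\<lambda>z. \<forall>i\<in>I. P i z"] by simp
qed

text \<open>The witness of genericity is open. Thus a generic identity holds in a neighbourhood
  within \<open>S\<close> of generic points, as is needed to differentiate it.\<close>

lemma generically_neighbourhood:
  assumes "generically S P"
  shows "generically S (\<lambda>z. \<exists>U. open U \<and> z \<in> U \<and> (\<forall>y\<in>S \<inter> U. P y))"
  using assms unfolding generically_def by blast

section \<open>Generic equality and generic regularity\<close>

lemma eq_on_refl: "eq_on S f f"
  unfolding eq_on_def by (rule generically_always) simp

lemma eq_on_eq: "(\<And>z. z \<in> S \<Longrightarrow> f z = g z) \<Longrightarrow> eq_on S f g"
  unfolding eq_on_def by (rule generically_always)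

lemma eq_on_sym: "eq_on S f g \<Longrightarrow> eq_on S g f"
  unfolding eq_on_def by (erule generically_mono) simp

text \<open>Rests on the openness of the sets in \<open>generically\<close>: two sets that are
  merely dense could be disjoint.\<close>

lemma eq_on_trans [trans]:
  assumes "eq_on S f g" "eq_on S g h"
  shows "eq_on S f h"
  using generically_conj[OF assms[unfolded eq_on_def]] unfolding eq_on_def
  by (rule generically_mono) simp

lemma eq_on_sum:
  assumes "finite I" "\<And>i. i \<in> I \<Longrightarrow> eq_on S (f i) (g i)"
  shows "eq_on S (\<lambda>z. \<Sum>i\<in>I. f i z) (\<lambda>z. \<Sum>i\<in>I. g i z)"
proof -
  have "generically S (\<lambda>z. \<forall>i\<in>I. f i z = g i z)"
    using assms unfolding eq_on_def by (intro generically_ball)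
  then show ?thesis unfolding eq_on_def by (rule generically_mono) simp
qed

lemma eq_on_mult_left: "eq_on S f g \<Longrightarrow> eq_on S (\<lambda>z. a z * f z) (\<lambda>z. a z * g z)"
  unfolding eq_on_def by (erule generically_mono) simp

lemma eq_on_diff:
  assumes "eq_on S f g" "eq_on S h k"
  shows "eq_on S (\<lambda>z. f z - h z) (\<lambda>z. g z - k z)"
  using generically_conj[OF assms[unfolded eq_on_def]] unfolding eq_on_def
  by (rule generically_mono) simp

text \<open>The local half of \<open>meromorphic_along\<close>. It suffices for differentiating, and
  avoids the question whether derivatives are again global quotients depending on finitely many
  coordinates.\<close>

definition generically_regular :: "'c pt set \<Rightarrow> 'c pfun \<Rightarrow> bool" where
  "generically_regular S f \<longleftrightarrow> generically S (regular f)"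

lemma generically_regular_const: "generically_regular S (\<lambda>_. a)"
  unfolding generically_regular_def by (intro generically_always regular_const)

lemma generically_regular_add:
  assumes "generically_regular S f" "generically_regular S g"
  shows "generically_regular S (\<lambda>z. f z + g z)"
  using generically_conj[OF assms[unfolded generically_regular_def]] unfolding generically_regular_def
  by (rule generically_mono) (auto intro: regular_add)

lemma generically_regular_mult:
  assumes "generically_regular S f" "generically_regular S g"
  shows "generically_regular S (\<lambda>z. f z * g z)"
  using generically_conj[OF assms[unfolded generically_regular_def]] unfolding generically_regular_def
  by (rule generically_mono) (auto intro: regular_mult)

lemma generically_regular_sum:
  "(\<And>i. i \<in> I \<Longrightarrow> generically_regular S (f i)) \<Longrightarrow> generically_regular S (\<lambda>z. \<Sum>i\<in>I. f i z)"
  by (induction I rule: infinite_finite_induct) (auto intro: generically_regular_const generically_regular_add)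

lemma generically_regular_cong:
  assumes "open V" "S \<subseteq> V" "\<And>z. z \<in> V \<Longrightarrow> f z = g z" "generically_regular S f"
  shows "generically_regular S g"
  using assms(4) unfolding generically_regular_def
proof (rule generically_mono)
  fix z assume "z \<in> S" "regular f z"
  then show "regular g z" using assms(2) by (intro regular_cong[OF assms(1) _ assms(3)]) auto
qed


section \<open>Powers of commuting derivations\<close>

lemma multi_pow_closed:
  assumes "\<And>j f. G f \<Longrightarrow> G (D j f)" "G f"
  shows "G (multi_pow D \<sigma> f)"
proof -
  have pow: "G ((D j ^^ k) f)" if "G f" for j k f
    using that assms(1) by (induction k) auto
  have "G (foldr (\<lambda>j. D j ^^ \<sigma> j) xs f)" for xs
    by (induction xs) (auto intro: pow assms(2))
  then show ?thesis by (simp add: multi_pow_def)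
qed

text \<open>The two sides may have different types. Suitable relations \<open>R\<close> carry
  statements linking a function with a family of functions, or an operator with a function, through
  all iterated derivatives.\<close>

lemma multi_pow_rel:
  assumes "\<And>j f g. R f g \<Longrightarrow> R (D j f) (D' j g)" "R f g"
  shows "R (multi_pow D \<sigma> f) (multi_pow D' \<sigma> g)"
proof -
  have pow: "R ((D j ^^ k) f) ((D' j ^^ k) g)" if "R f g" for j k f g
    using that assms(1) by (induction k) auto
  have "R (foldr (\<lambda>j. D j ^^ \<sigma> j) xs f) (foldr (\<lambda>j. D' j ^^ \<sigma> j) xs g)" for xs
    by (induction xs) (auto intro: pow assms(2))
  then show ?thesis by (simp add: multi_pow_def)
qed

text \<open>The factors of \<open>multi_pow\<close> are ordered, so the additional
  \<open>D j\<close> has to travel inwards to the factor of index \<open>j\<close>. \<open>G\<close>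
  is the class on which commutation is known and \<open>R\<close> the equality up to which it holds;
  exact equality on an open set and generic equality are both instances.\<close>

lemma multi_pow_Suc:
  fixes D :: "'d :: {finite, linorder} \<Rightarrow> 'a \<Rightarrow> 'a"
  assumes closed: "\<And>j f. G f \<Longrightarrow> G (D j f)"
    and refl: "\<And>f. R f f" and trans: "\<And>f g h. R f g \<Longrightarrow> R g h \<Longrightarrow> R f h"
    and cong: "\<And>j f g. G f \<Longrightarrow> G g \<Longrightarrow> R f g \<Longrightarrow> R (D j f) (D j g)"
    and comm: "\<And>i j f. G f \<Longrightarrow> R (D i (D j f)) (D j (D i f))"
    and f: "G f"
  shows "R (D j (multi_pow D \<sigma> f)) (multi_pow D (\<sigma>(j := Suc (\<sigma> j))) f)"
proof -
  have pow_closed: "G ((D i ^^ k) g)" if "G g" for i k g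
    using that closed by (induction k) auto
  have pow_cong: "R ((D i ^^ k) g) ((D i ^^ k) h)" if "G g" "G h" "R g h" for i k g h
    by (induction k) (auto intro: cong pow_closed that)
  have pow_comm: "R (D j ((D i ^^ k) g)) ((D i ^^ k) (D j g))" if g: "G g" for i k g
  proof (induction k)
    case (Suc k)
    have "R (D j (D i ((D i ^^ k) g))) (D i (D j ((D i ^^ k) g)))"
      by (intro comm pow_closed g)
    moreover have "R (D i (D j ((D i ^^ k) g))) (D i ((D i ^^ k) (D j g)))"
      by (intro cong Suc.IH closed pow_closed g)
    ultimately show ?case by (auto intro: trans)
  qed (simp add: refl)
  have fold_closed: "G (foldr (\<lambda>j. D j ^^ \<sigma> j) xs f)" for xs and \<sigma> :: "'d \<Rightarrow> nat"
    by (induction xs) (auto intro: pow_closed f)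
  \<comment> \<open>By distinctness the list behind the factor \<open>j\<close> contains no further
    \<open>j\<close>, so raising the exponent at \<open>j\<close> leaves that tail
    unchanged.\<close>
  have "R (D j (foldr (\<lambda>j. D j ^^ \<sigma> j) xs f)) (foldr (\<lambda>i. D i ^^ (\<sigma>(j := Suc (\<sigma> j))) i) xs f)"
    if "distinct xs" "j \<in> set xs" for xs
    using that
  proof (induction xs)
    case (Cons x xs)
    show ?case
    proof (cases "x = j")
      case True
      then have "foldr (\<lambda>i. D i ^^ (\<sigma>(j := Suc (\<sigma> j))) i) xs f = foldr (\<lambda>j. D j ^^ \<sigma> j) xs f"
        using Cons.prems by (intro foldr_cong) auto
      then show ?thesis using True by (simp add: refl)
    next
      case False
      have "R (D j ((D x ^^ \<sigma> x) (foldr (\<lambda>j. D j ^^ \<sigma> j) xs f)))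
          ((D x ^^ \<sigma> x) (D j (foldr (\<lambda>j. D j ^^ \<sigma> j) xs f)))"
        by (intro pow_comm fold_closed)
      moreover have "R ((D x ^^ \<sigma> x) (D j (foldr (\<lambda>j. D j ^^ \<sigma> j) xs f)))
          ((D x ^^ \<sigma> x) (foldr (\<lambda>i. D i ^^ (\<sigma>(j := Suc (\<sigma> j))) i) xs f))"
        using Cons False by (intro pow_cong closed fold_closed) auto
      ultimately show ?thesis using False by (auto intro: trans)
    qed
  qed simp
  from this[of "sorted_list_of_set UNIV"] show ?thesis by (simp add: multi_pow_def)
qed

text \<open>What the calculus uses of the total derivatives on a covering. As \<open>v j c\<close>
  is the derivative of the coordinate \<open>c\<close>, the assumption \<open>commuting\<close>
  concerns coordinates only; \<open>D_commute\<close> extends it to all generically regular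
  functions.\<close>

locale flat_fields =
  fixes S :: "'c pt set" and v :: "'d :: {finite, linorder} \<Rightarrow> 'c \<Rightarrow> 'c pfun"
  assumes tangent: "z \<in> S \<Longrightarrow> (\<lambda>c. v j c z) \<in> tangent_space S z"
    and regular_fields: "generically_regular S (v j c)"
    and commuting: "eq_on S (lie (v i) (v j c)) (lie (v j) (v i c))"
begin

abbreviation D :: "'d \<Rightarrow> 'c pfun \<Rightarrow> 'c pfun" where
  "D j \<equiv> lie (v j)"

abbreviation DD :: "('d \<Rightarrow> nat) \<Rightarrow> 'c pfun \<Rightarrow> 'c pfun" where
  "DD \<equiv> multi_pow D"

text \<open>Where \<open>f\<close> depends on the finite set \<open>T\<close>, only the components
  indexed by \<open>T\<close> matter, and finitely many components are regular simultaneously at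
  generic points.\<close>

lemma D_closed:
  assumes "generically_regular S f"
  shows "generically_regular S (D j f)"
  unfolding generically_regular_def
proof (rule generically_local)
  show "generically S (regular f)" using assms unfolding generically_regular_def .
  fix z assume "z \<in> S" "regular f z"
  then obtain V T where V: "open V" "z \<in> V" "finite T" "holo V T f" using regularE by blast
  have "generically (S \<inter> V) (\<lambda>y. \<forall>c\<in>T. regular (v j c) y)"
    using regular_fields V by (intro generically_ball generically_Int) (auto simp: generically_regular_def)
  then have "generically (S \<inter> V) (regular (D j f))"
    by (rule generically_mono) (use V in \<open>auto intro: regular_lie[of V T]\<close>)
  then show "\<exists>U. open U \<and> z \<in> U \<and> generically (S \<inter> U) (regular (D j f))" using V by blast
qed

text \<open>Here tangency is used: \<open>f\<close> and \<open>g\<close> may be unrelated off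
  \<open>S\<close>, but the fields differentiate along \<open>S\<close> only.\<close>

lemma D_cong:
  assumes f: "generically_regular S f" and g: "generically_regular S g" and fg: "eq_on S f g"
  shows "eq_on S (D j f) (D j g)"
proof -
  have "generically S (\<lambda>z. (regular f z \<and> regular g z) \<and> (\<exists>U. open U \<and> z \<in> U \<and> (\<forall>y\<in>S \<inter> U. f y = g y)))"
    using assms unfolding generically_regular_def eq_on_def
    by (intro generically_conj generically_neighbourhood)
  then show ?thesis
    unfolding eq_on_def
  proof (rule generically_mono, elim conjE exE)
    fix z U assume "z \<in> S" "regular f z" "regular g z" "open U" "z \<in> U" "\<forall>y\<in>S \<inter> U. f y = g y"
    then show "D j f z = D j g z"
      unfolding lie_def by (intro differential_eq_tangent[OF tangent, of z U]) auto
  qed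
qed

lemma D_commute:
  assumes "generically_regular S f"
  shows "eq_on S (D i (D j f)) (D j (D i f))"
  unfolding eq_on_def
proof (rule generically_local)
  show "generically S (regular f)" using assms unfolding generically_regular_def .
  fix z assume "z \<in> S" "regular f z"
  then obtain V T where V: "open V" "z \<in> V" "finite T" "holo V T f" using regularE by blast
  have "generically (S \<inter> V) (\<lambda>y. \<forall>c\<in>T. (regular (v i c) y \<and> regular (v j c) y) \<and> D i (v j c) y = D j (v i c) y)"
    using regular_fields commuting V
    by (intro generically_ball generically_Int generically_conj) (auto simp: generically_regular_def eq_on_def)
  then have "generically (S \<inter> V) (\<lambda>y. D i (D j f) y = D j (D i f) y)"
    by (rule generically_mono) (use V in \<open>auto intro: lie_commute[of V T]\<close>)
  then show "\<exists>U. open U \<and> z \<in> U \<and> generically (S \<inter> U) (\<lambda>y. D i (D j f) y = D j (D i f) y)"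
    using V by blast
qed

lemma D_sum:
  assumes "finite I" "\<And>i. i \<in> I \<Longrightarrow> generically_regular S (f i)"
  shows "eq_on S (D j (\<lambda>z. \<Sum>i\<in>I. f i z)) (\<lambda>z. \<Sum>i\<in>I. D j (f i) z)"
proof -
  have "generically S (\<lambda>z. \<forall>i\<in>I. regular (f i) z)"
    using assms unfolding generically_regular_def by (intro generically_ball)
  then show ?thesis unfolding eq_on_def by (rule generically_mono) (auto intro: lie_sum)
qed

lemma D_mult:
  assumes "generically_regular S f" "generically_regular S g"
  shows "eq_on S (D j (\<lambda>z. f z * g z)) (\<lambda>z. D j f z * g z + f z * D j g z)"
  using generically_conj[OF assms[unfolded generically_regular_def]] unfolding eq_on_def
  by (rule generically_mono) (auto intro: lie_mult)

lemma DD_closed: "generically_regular S f \<Longrightarrow> generically_regular S (DD \<sigma> f)"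
  by (rule multi_pow_closed[of "generically_regular S"]) (rule D_closed)

lemma DD_cong:
  assumes "generically_regular S f" "generically_regular S g" "eq_on S f g"
  shows "eq_on S (DD \<sigma> f) (DD \<sigma> g)"
proof -
  let ?R = "\<lambda>f g. generically_regular S f \<and> generically_regular S g \<and> eq_on S f g"
  have "?R (DD \<sigma> f) (DD \<sigma> g)"
    by (rule multi_pow_rel[of ?R]) (use D_closed D_cong assms in auto)
  then show ?thesis by simp
qed

lemma DD_sum:
  assumes I: "finite I" "\<And>i. i \<in> I \<Longrightarrow> generically_regular S (f i)"
  shows "eq_on S (DD \<sigma> (\<lambda>z. \<Sum>i\<in>I. f i z)) (\<lambda>z. \<Sum>i\<in>I. DD \<sigma> (f i) z)"
proof -
  \<comment> \<open>Relates a function to a family of which it is generically the sum; the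
    derivations act on a family member by member.\<close>
  let ?R = "\<lambda>F h. generically_regular S F \<and> (\<forall>i\<in>I. generically_regular S (h i)) \<and> eq_on S F (\<lambda>z. \<Sum>i\<in>I. h i z)"
  have "?R (DD \<sigma> (\<lambda>z. \<Sum>i\<in>I. f i z)) (multi_pow (\<lambda>j h i. D j (h i)) \<sigma> f)"
  proof (rule multi_pow_rel[of ?R])
    fix j F h assume R: "?R F h"
    have "eq_on S (D j F) (D j (\<lambda>z. \<Sum>i\<in>I. h i z))"
      using R by (intro D_cong generically_regular_sum) auto
    also have "eq_on S \<dots> (\<lambda>z. \<Sum>i\<in>I. D j (h i) z)"
      using R I(1) by (intro D_sum) auto
    finally show "?R (D j F) (\<lambda>i. D j (h i))" using R D_closed by auto
  qed (use I in \<open>auto intro: generically_regular_sum eq_on_refl\<close>)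
  moreover have "multi_pow (\<lambda>j h i. D j (h i)) \<sigma> f i = DD \<sigma> (f i)" for i
    by (rule multi_pow_rel[of "\<lambda>h g. h i = g"]) auto
  ultimately show ?thesis by simp
qed

lemma D_DD: "generically_regular S f \<Longrightarrow> eq_on S (D j (DD \<sigma> f)) (DD (\<sigma>(j := Suc (\<sigma> j))) f)"
  by (rule multi_pow_Suc[of "generically_regular S" D "eq_on S"])
     (rule D_closed D_cong D_commute eq_on_refl eq_on_trans; assumption)+

end

section \<open>Total derivatives and coverings\<close>

lemma regular_total_field: "regular (total_field j c) z"
proof (cases c)
  case (Indep i)
  then show ?thesis using regular_const[of "if i = j then 1 else 0" z] by (simp add: total_field_def[abs_def])
next
  case (Dep \<alpha> \<sigma>)
  then show ?thesis using regular_coord[of "Dep \<alpha> (\<sigma>(j := Suc (\<sigma> j)))" z] by (simp add: total_field_def[abs_def])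
qed

text \<open>On \<open>Dep \<alpha> \<sigma>\<close> both sides raise the entries \<open>i\<close>
  and \<open>j\<close> of the multi-index, in opposite orders.\<close>

lemma lie_total_field_commute:
  "lie (total_field i) (total_field j c) z = lie (total_field j) (total_field i c) z"
proof (cases c)
  case (Indep k)
  then show ?thesis by (simp add: total_field_def[abs_def] lie_const)
next
  case (Dep \<alpha> \<sigma>)
  have *: "total_field j (Dep \<alpha> \<sigma>) = (\<lambda>z. z (Dep \<alpha> (\<sigma>(j := Suc (\<sigma> j)))))" for j
    by (simp add: total_field_def[abs_def])
  show ?thesis
    by (cases "i = j") (simp_all add: Dep * lie_coord, simp add: total_field_def fun_upd_twist)
qed

lemma regular_tot: "regular f z \<Longrightarrow> regular (tot j f) z"
  unfolding tot_def by (erule regularE) (rule regular_lie, assumption+, rule regular_total_field)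

lemma tot_commute: "regular f z \<Longrightarrow> tot i (tot j f) z = tot j (tot i f) z"
  unfolding tot_def
  by (erule regularE) (rule lie_commute, assumption+, (rule regular_total_field lie_total_field_commute)+)

text \<open>An exact identity at every regular point rather than a generic one, because tangency is
  required at every point of the solution set. The regular points of \<open>f\<close> form an open
  set, and regularity there is kept by \<open>tot\<close>.\<close>

lemma tot_multi_pow:
  fixes f :: "('d :: {finite, linorder}, 'n) jfun"
  assumes "regular f z"
  shows "tot j (multi_pow tot \<sigma> f) z = multi_pow tot (\<sigma>(j := Suc (\<sigma> j))) f z"
proof -
  let ?U = "{z. regular f z}"
  let ?G = "\<lambda>g. \<forall>y\<in>?U. regular g y" and ?R = "\<lambda>g h. \<forall>y\<in>?U. g y = h y"
  have "?R (tot j (multi_pow tot \<sigma> f)) (multi_pow tot (\<sigma>(j := Suc (\<sigma> j))) f)"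
  proof (rule multi_pow_Suc[of ?G tot ?R])
    show "?R (tot j g) (tot j h)" if "?R g h" for j g h
      using that unfolding tot_def by (auto intro: lie_cong[OF open_regular])
  qed (auto simp: regular_tot tot_commute)
  then show ?thesis using assms by simp
qed

text \<open>The tangent space is a common kernel, and the differential of a consequence of the
  system evaluated on the field is the consequence with \<open>\<sigma>\<close> raised at
  \<open>j\<close>, which vanishes on solutions as well.\<close>

lemma total_field_tangent:
  assumes "regular_system \<Omega> F" "z \<in> solution_set \<Omega> F"
  shows "(\<lambda>c. total_field j c z) \<in> tangent_space (solution_set \<Omega> F) z"
proof -
  have "differential (multi_pow tot \<sigma> (F I)) z (\<lambda>c. total_field j c z) = 0" for I \<sigma>
  proof -
    have "regular (F I) z" "multi_pow tot (\<sigma>(j := Suc (\<sigma> j))) (F I) z = 0"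
      using assms(2) by (simp_all add: solution_set_def)
    then have "tot j (multi_pow tot \<sigma> (F I)) z = 0"
      by (simp only: tot_multi_pow)
    then show ?thesis by (simp only: tot_def lie_def)
  qed
  then show ?thesis
    unfolding bspec[OF assms(1)[unfolded regular_system_def] assms(2)] by blast
qed

section \<open>Lifting from jets to a covering\<close>

lemma continuous_on_base: "continuous_on T base"
  unfolding base_def
  by (rule continuous_on_coordinatewise_then_product, rule continuous_on_product_then_coordinatewise,
      rule continuous_on_id)

lemma base_update_Inl: "base (z(Inl b := t)) = (base z)(b := t)"
  by (auto simp: base_def)

lemma base_update_Inr: "base (z(Inr a := t)) = base z"
  by (auto simp: base_def)

lemma regular_base:
  fixes z :: "('d, 'n, 'w) cpt"
  assumes "regular f (base z)"
  shows "regular (\<lambda>y. f (base y)) z"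
proof -
  obtain V T where V: "open V" "base z \<in> V" "finite T" "holo V T f" using assms by (rule regularE)
  have "holo (base -` V) (Inl ` T) (\<lambda>y :: ('d, 'n, 'w) cpt. f (base y))"
    unfolding holo_def
  proof (intro conjI ballI)
    have dep: "depends_only V T f" and cont: "continuous_on V f" using V(4) by (auto simp: holo_def)
    show "depends_only (base -` V) (Inl ` T) (\<lambda>y :: ('d, 'n, 'w) cpt. f (base y))"
      unfolding depends_only_def
    proof (intro ballI impI)
      fix y y' :: "('d, 'n, 'w) cpt"
      assume "y \<in> base -` V" "y' \<in> base -` V" "\<forall>c\<in>Inl ` T. y c = y' c"
      then have "base y \<in> V" "base y' \<in> V" "\<forall>b\<in>T. base y b = base y' b" by (simp_all add: base_def)
      then show "f (base y) = f (base y')"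
        using dep unfolding depends_only_def by blast
    qed
    show "continuous_on (base -` V) (\<lambda>y :: ('d, 'n, 'w) cpt. f (base y))"
      by (rule continuous_on_compose2[OF cont continuous_on_base]) auto
    fix y :: "('d, 'n, 'w) cpt" and c :: "('d, 'n) jcoord + 'w" assume "y \<in> base -` V" "c \<in> Inl ` T"
    then obtain b where "c = Inl b" "b \<in> T" "base y \<in> V" by auto
    then show "(\<lambda>t. f (base (y(c := t)))) field_differentiable at (y c)"
      using holo_has_partial_at[OF V(1,4), of "base y" b]
      unfolding field_differentiable_def by (auto simp: base_update_Inl) (auto simp: base_def)
  qed
  moreover have "open (base -` V :: ('d, 'n, 'w) cpt set)"
    by (rule open_vimage[OF V(1) continuous_on_base])
  ultimately show ?thesis using V by (intro regularI[of "base -` V" z "Inl ` T"]) auto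
qed

lemma cov_tot_base: "cov_tot X j (\<lambda>y. f (base y)) z = tot j f (base z)"
proof -
  have Inl: "partial (Inl b) (\<lambda>y. f (base y)) z = partial b f (base z)" for b
    by (simp add: partial_def base_update_Inl) (simp add: base_def)
  have Inr: "partial (Inr a) (\<lambda>y. f (base y)) z = 0" for a
    by (simp add: partial_def base_update_Inr)
  let ?g = "\<lambda>b. partial b f (base z) * total_field j b (base z)"
  \<comment> \<open>The supports correspond under \<open>Inl\<close>. If they are infinite, both
    occurrences of \<open>Sum_any\<close> are 0, so the identity holds for arbitrary
    \<open>f\<close>.\<close>
  have "{c. partial c (\<lambda>y. f (base y)) z * cov_field X j c z \<noteq> 0} = Inl ` {b. ?g b \<noteq> 0}"
  proof (rule set_eqI)
    fix c show "c \<in> {c. partial c (\<lambda>y. f (base y)) z * cov_field X j c z \<noteq> 0} \<longleftrightarrow> c \<in> Inl ` {b. ?g b \<noteq> 0}"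
      by (cases c) (auto simp: Inl Inr cov_field_def)
  qed
  then show ?thesis
    by (simp add: cov_tot_def tot_def lie_def differential_def Sum_any.expand_set sum.reindex Inl cov_field_def)
qed

lemma generically_base:
  fixes \<Omega>' :: "('d :: {finite, linorder}, 'n, 'w) cpt set"
  assumes "open \<Omega>'" "generically (solution_set \<Omega> F) P"
  shows "generically (cov_solution_set \<Omega> F \<Omega>') (\<lambda>z. P (base z))"
  unfolding generically_iff
proof (intro allI impI)
  fix W assume W: "open W" "cov_solution_set \<Omega> F \<Omega>' \<inter> W \<noteq> {}"
  then obtain z where z: "z \<in> W" "z \<in> \<Omega>'" "base z \<in> solution_set \<Omega> F"
    by (auto simp: cov_solution_set_def)
  \<comment> \<open>The section of \<open>base\<close> through \<open>z\<close> with the nonlocal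
    coordinates frozen. Pulling an open set of the covering back along it gives an open set of jets,
    where density on the base applies.\<close>
  define glue where "glue = (\<lambda>b :: ('d, 'n) jet. case_sum b (\<lambda>a. z (Inr a)))"
  have glue: "base (glue b) = b" "glue (base z) = z" for b
    by (auto simp: glue_def base_def split: sum.splits)
  have cont: "continuous_on UNIV glue"
  proof (rule continuous_on_coordinatewise_then_product)
    fix c show "continuous_on UNIV (\<lambda>b. glue b c)"
      by (cases c) (simp_all add: glue_def)
  qed
  have "open (glue -` (W \<inter> \<Omega>'))" using W(1) assms(1) by (intro open_vimage cont) auto
  moreover have "solution_set \<Omega> F \<inter> glue -` (W \<inter> \<Omega>') \<noteq> {}" using z glue(2) by auto
  ultimately obtain V where V: "open V" "V \<subseteq> glue -` (W \<inter> \<Omega>')" "solution_set \<Omega> F \<inter> V \<noteq> {}"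
    "\<And>y. y \<in> solution_set \<Omega> F \<Longrightarrow> y \<in> V \<Longrightarrow> P y"
    using genericallyE[OF assms(2)] by metis
  then obtain y where y: "y \<in> solution_set \<Omega> F" "y \<in> V" by blast
  have "open (base -` V \<inter> W)" using open_vimage[OF V(1) continuous_on_base] W(1) by auto
  moreover have "glue y \<in> cov_solution_set \<Omega> F \<Omega>' \<inter> (base -` V \<inter> W)"
    using y V(2) glue(1) by (auto simp: cov_solution_set_def)
  ultimately show "\<exists>V. open V \<and> V \<subseteq> W \<and> cov_solution_set \<Omega> F \<Omega>' \<inter> V \<noteq> {} \<and>
      (\<forall>z\<in>cov_solution_set \<Omega> F \<Omega>' \<inter> V. P (base z))"
    using V(4) by (intro exI[of _ "base -` V \<inter> W"]) (auto simp: cov_solution_set_def)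
qed

lemma generically_regular_base:
  "open \<Omega>' \<Longrightarrow> generically_regular (solution_set \<Omega> F) f \<Longrightarrow>
    generically_regular (cov_solution_set \<Omega> F \<Omega>') (\<lambda>z. f (base z))"
  unfolding generically_regular_def
  by (rule generically_mono[OF generically_base]) (assumption+, rule regular_base)

lemma cov_field_tangent:
  assumes "open \<Omega>'" "regular_system \<Omega> F" and z: "z \<in> cov_solution_set \<Omega> F \<Omega>'"
  shows "(\<lambda>c. cov_field X j c z) \<in> tangent_space (cov_solution_set \<Omega> F \<Omega>') z"
proof -
  have "(\<lambda>c. total_field j c (base z)) \<in> tangent_space (solution_set \<Omega> F) (base z)"
    using z by (intro total_field_tangent assms(2)) (auto simp: cov_solution_set_def)
  then obtain \<phi> where \<phi>: "\<phi> 0 = base z" "\<forall>\<^sub>F t in nhds 0. \<phi> t \<in> solution_set \<Omega> F"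
    "\<And>c. ((\<lambda>t. \<phi> t c) has_field_derivative total_field j c (base z)) (at 0)"
    unfolding tangent_space_def by blast
  \<comment> \<open>The curve of jets is lifted by moving each nonlocal coordinate along a straight
    line with the prescribed velocity; apart from membership in the open set
    \<open>\<Omega>'\<close>, nothing constrains these coordinates.\<close>
  define \<psi> where "\<psi> = (\<lambda>t. case_sum (\<phi> t) (\<lambda>a. z (Inr a) + t * X j a z))"
  have \<psi>0: "\<psi> 0 = z" using \<phi>(1) by (auto simp: \<psi>_def base_def split: sum.splits)
  have d\<psi>: "((\<lambda>t. \<psi> t c) has_field_derivative cov_field X j c z) (at 0)" for c
  proof (cases c)
    case (Inr a)
    have "((\<lambda>t. z (Inr a) + t * X j a z) has_field_derivative X j a z) (at 0)"
      by (auto intro!: derivative_eq_intros)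
    then show ?thesis using Inr by (simp add: \<psi>_def cov_field_def)
  qed (use \<phi>(3) in \<open>simp add: \<psi>_def cov_field_def\<close>)
  have "\<forall>\<^sub>F t in nhds 0. \<psi> t \<in> \<Omega>'"
    using z by (intro eventually_curve_in assms(1) DERIV_isCont[OF d\<psi>]) (auto simp: \<psi>0 cov_solution_set_def)
  with \<phi>(2) have "\<forall>\<^sub>F t in nhds 0. \<psi> t \<in> cov_solution_set \<Omega> F \<Omega>'"
    by eventually_elim (auto simp: cov_solution_set_def \<psi>_def base_def)
  then show ?thesis using \<psi>0 d\<psi> unfolding tangent_space_def by blast
qed

lemma meromorphic_along_regular: "meromorphic_along \<Omega> S f \<Longrightarrow> generically_regular S f"
  by (simp add: meromorphic_along_def generically_regular_def)

text \<open>Commutation in \<open>differential_covering\<close> is stated for meromorphic functions;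
  this admits the coordinates as test functions, each being the quotient of itself by 1.\<close>

lemma meromorphic_along_coord:
  assumes "open \<Omega>"
  shows "meromorphic_along \<Omega> S (\<lambda>z. z c)"
proof -
  have holo: "holo \<Omega> {c} (\<lambda>z. z c)" "holo \<Omega> {c} (\<lambda>_. 1)"
    by (auto simp: holo_def depends_only_def intro: continuous_on_subset[OF continuous_on_product_coordinates])
  have "meromorphic_function \<Omega> (\<lambda>z. z c)"
    unfolding meromorphic_function_def
  proof (intro exI[of _ "{c}"] conjI ballI)
    fix z assume z: "z \<in> \<Omega>"
    show "\<exists>V g h. open V \<and> z \<in> V \<and> V \<subseteq> \<Omega> \<and> holo V {c} g \<and> holo V {c} h \<and>
        V \<subseteq> closure {y\<in>V. h y \<noteq> 0} \<and> (\<forall>y\<in>V. h y \<noteq> 0 \<longrightarrow> y c = g y / h y)"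
      using assms z holo closure_subset[of \<Omega>]
      by (intro exI[of _ \<Omega>] exI[of _ "\<lambda>z. z c"] exI[of _ "\<lambda>_. 1"]) auto
  qed (auto simp: depends_only_def)
  then show ?thesis
    by (auto simp: meromorphic_along_def intro: generically_always regular_coord)
qed

lemma flat_fields_covering:
  fixes X :: "'d :: {finite, linorder} \<Rightarrow> 'w \<Rightarrow> ('d, 'n, 'w) cfun"
  assumes sys: "regular_system \<Omega> F" and cov: "differential_covering \<Omega> F \<Omega>' X"
  shows "flat_fields (cov_solution_set \<Omega> F \<Omega>') (cov_field X)"
proof
  have op: "open \<Omega>'" using cov by (simp add: differential_covering_def)
  show "(\<lambda>c. cov_field X j c z) \<in> tangent_space (cov_solution_set \<Omega> F \<Omega>') z"
    if "z \<in> cov_solution_set \<Omega> F \<Omega>'" for j z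
    using cov_field_tangent[OF op sys that] .
  show "generically_regular (cov_solution_set \<Omega> F \<Omega>') (cov_field X j c)" for j c
  proof (cases c)
    case (Inl b)
    have "generically_regular (cov_solution_set \<Omega> F \<Omega>') (\<lambda>z. total_field j b (base z))"
      unfolding generically_regular_def by (intro generically_always regular_base regular_total_field)
    then show ?thesis using Inl by (simp add: cov_field_def[abs_def])
  next
    case (Inr a)
    then show ?thesis
      using cov meromorphic_along_regular[of \<Omega>' "cov_solution_set \<Omega> F \<Omega>'" "X j a"]
      by (simp add: cov_field_def[abs_def] differential_covering_def)
  qed
  show "eq_on (cov_solution_set \<Omega> F \<Omega>') (lie (cov_field X i) (cov_field X j c)) (lie (cov_field X j) (cov_field X i c))"
    for i j c
  proof -
    have "cov_tot X j (\<lambda>z. z c) = cov_field X j c" for j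
      by (rule ext) (simp add: cov_tot_def lie_coord)
    moreover have "eq_on (cov_solution_set \<Omega> F \<Omega>')
        (cov_tot X i (cov_tot X j (\<lambda>z. z c))) (cov_tot X j (cov_tot X i (\<lambda>z. z c)))"
      using cov meromorphic_along_coord[OF op] unfolding differential_covering_def by blast
    ultimately show ?thesis by (simp add: cov_tot_def)
  qed
qed

section \<open>Differential operators\<close>

text \<open>The finite support is uniform over the open set \<open>\<Omega>\<close>, not only over
  solutions: a coefficient vanishing on an open set has vanishing total derivatives there, so
  compositions keep a finite support.\<close>

definition finite_order :: "('d, 'n) jet set \<Rightarrow> ('d, 'n) dop \<Rightarrow> bool" where
  "finite_order \<Omega> P \<longleftrightarrow> (\<exists>T. finite T \<and> (\<forall>\<tau>. \<tau> \<notin> T \<longrightarrow> (\<forall>z\<in>\<Omega>. P \<tau> z = 0)))"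

lemma finite_orderI:
  "finite T \<Longrightarrow> (\<And>\<tau> z. \<tau> \<notin> T \<Longrightarrow> z \<in> \<Omega> \<Longrightarrow> P \<tau> z = 0) \<Longrightarrow> finite_order \<Omega> P"
  unfolding finite_order_def by blast

lemma finite_orderE:
  assumes "finite_order \<Omega> P"
  obtains T where "finite T" "\<And>\<tau> z. \<tau> \<notin> T \<Longrightarrow> z \<in> \<Omega> \<Longrightarrow> P \<tau> z = 0"
  using assms unfolding finite_order_def by blast

lemma tot_eq_0: "open \<Omega> \<Longrightarrow> (\<And>y. y \<in> \<Omega> \<Longrightarrow> f y = 0) \<Longrightarrow> z \<in> \<Omega> \<Longrightarrow> tot j f z = 0"
  unfolding tot_def using lie_cong[of \<Omega> z f "\<lambda>_. 0"] by (simp add: lie_const)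

lemma finite_order_tot_comp:
  assumes "open \<Omega>" "finite_order \<Omega> Q"
  shows "finite_order \<Omega> (tot_comp j Q)"
proof -
  obtain T where T: "finite T" "\<And>\<tau> z. \<tau> \<notin> T \<Longrightarrow> z \<in> \<Omega> \<Longrightarrow> Q \<tau> z = 0"
    using finite_orderE[OF assms(2)] by blast
  show ?thesis
  proof (rule finite_orderI)
    show "finite (T \<union> (\<lambda>\<tau>. \<tau>(j := Suc (\<tau> j))) ` T)" using T(1) by simp
    fix \<tau> z assume \<tau>: "\<tau> \<notin> T \<union> (\<lambda>\<tau>. \<tau>(j := Suc (\<tau> j))) ` T" and z: "z \<in> \<Omega>"
    have "tot j (Q \<tau>) z = 0" using T(2) \<tau> z by (intro tot_eq_0[OF assms(1)]) auto
    moreover have "Q (\<tau>(j := \<tau> j - 1)) z = 0" if "\<tau> j > 0"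
    proof (rule T(2)[OF _ z])
      \<comment> \<open>A multi-index with positive entry at \<open>j\<close> is the shift of its
        predecessor; lying outside the shifted support, it has its predecessor outside
        \<open>T\<close>.\<close>
      have "\<tau> = (\<tau>(j := \<tau> j - 1))(j := Suc ((\<tau>(j := \<tau> j - 1)) j))" using that by auto
      then show "\<tau>(j := \<tau> j - 1) \<notin> T" using \<tau> by blast
    qed
    ultimately show "tot_comp j Q \<tau> z = 0" by (simp add: tot_comp_def)
  qed
qed

lemma multi_pow_tot_comp_eq_0:
  assumes "open \<Omega>" "\<And>\<tau> z. z \<in> \<Omega> \<Longrightarrow> Q \<tau> z = 0" "z \<in> \<Omega>"
  shows "multi_pow tot_comp \<sigma> Q \<tau> z = 0"
proof -
  let ?G = "\<lambda>Q. \<forall>\<tau>. \<forall>z\<in>\<Omega>. Q \<tau> z = 0"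
  have "?G (multi_pow tot_comp \<sigma> Q)"
    by (rule multi_pow_closed[of ?G]) (auto simp: tot_comp_def tot_eq_0[OF assms(1)] assms(2))
  then show ?thesis using assms(3) by blast
qed

lemma finite_order_multi_pow:
  "open \<Omega> \<Longrightarrow> finite_order \<Omega> Q \<Longrightarrow> finite_order \<Omega> (multi_pow tot_comp \<sigma> Q)"
  by (rule multi_pow_closed[of "finite_order \<Omega>"]) (rule finite_order_tot_comp)

text \<open>One finite \<open>K\<close> works for all \<open>\<sigma> \<in> T\<close> at once, so
  compositions and their applications become finite double sums that can be interchanged.\<close>

lemma dop_comp_expand:
  assumes "open \<Omega>" "finite_order \<Omega> P" "finite_order \<Omega> Q"
  obtains T K where "finite T" "finite K"
    "\<And>\<sigma> z. \<sigma> \<notin> T \<Longrightarrow> z \<in> \<Omega> \<Longrightarrow> P \<sigma> z = 0"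
    "\<And>\<sigma> \<tau> z. \<sigma> \<in> T \<Longrightarrow> \<tau> \<notin> K \<Longrightarrow> z \<in> \<Omega> \<Longrightarrow> multi_pow tot_comp \<sigma> Q \<tau> z = 0"
    "\<And>\<tau> z. z \<in> \<Omega> \<Longrightarrow> dop_comp P Q \<tau> z = (\<Sum>\<sigma>\<in>T. P \<sigma> z * multi_pow tot_comp \<sigma> Q \<tau> z)"
proof -
  obtain T where T: "finite T" "\<And>\<sigma> z. \<sigma> \<notin> T \<Longrightarrow> z \<in> \<Omega> \<Longrightarrow> P \<sigma> z = 0"
    using finite_orderE[OF assms(2)] by blast
  have "\<forall>\<sigma>. \<exists>K. finite K \<and> (\<forall>\<tau>. \<tau> \<notin> K \<longrightarrow> (\<forall>z\<in>\<Omega>. multi_pow tot_comp \<sigma> Q \<tau> z = 0))"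
    using finite_order_multi_pow[OF assms(1,3)] unfolding finite_order_def by blast
  then obtain K where K: "\<And>\<sigma>. finite (K \<sigma>)"
    "\<And>\<sigma> \<tau> z. \<tau> \<notin> K \<sigma> \<Longrightarrow> z \<in> \<Omega> \<Longrightarrow> multi_pow tot_comp \<sigma> Q \<tau> z = 0" by metis
  show thesis
  proof (rule that[OF T(1) _ T(2)])
    show "finite (\<Union>\<sigma>\<in>T. K \<sigma>)" using T K by auto
    show "multi_pow tot_comp \<sigma> Q \<tau> z = 0" if "\<sigma> \<in> T" "\<tau> \<notin> (\<Union>\<sigma>\<in>T. K \<sigma>)" "z \<in> \<Omega>" for \<sigma> \<tau> z
      using K that by auto
    show "dop_comp P Q \<tau> z = (\<Sum>\<sigma>\<in>T. P \<sigma> z * multi_pow tot_comp \<sigma> Q \<tau> z)" if "z \<in> \<Omega>" for \<tau> z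
      unfolding dop_comp_def using T that by (intro Sum_any.expand_superset) auto
  qed
qed

lemma finite_order_dop_comp:
  assumes "open \<Omega>" "finite_order \<Omega> P" "finite_order \<Omega> Q"
  shows "finite_order \<Omega> (dop_comp P Q)"
proof -
  obtain T K where *: "finite T" "finite K"
    "\<And>\<sigma> z. \<sigma> \<notin> T \<Longrightarrow> z \<in> \<Omega> \<Longrightarrow> P \<sigma> z = 0"
    "\<And>\<sigma> \<tau> z. \<sigma> \<in> T \<Longrightarrow> \<tau> \<notin> K \<Longrightarrow> z \<in> \<Omega> \<Longrightarrow> multi_pow tot_comp \<sigma> Q \<tau> z = 0"
    "\<And>\<tau> z. z \<in> \<Omega> \<Longrightarrow> dop_comp P Q \<tau> z = (\<Sum>\<sigma>\<in>T. P \<sigma> z * multi_pow tot_comp \<sigma> Q \<tau> z)"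
    using dop_comp_expand[OF assms] by blast
  show ?thesis using *(2) by (rule finite_orderI) (simp add: *(4,5))
qed

lemma finite_order_adjoint:
  assumes "open \<Omega>" "finite_order \<Omega> P"
  shows "finite_order \<Omega> (dop_adjoint P)"
proof -
  obtain T where T: "finite T" "\<And>\<sigma> z. \<sigma> \<notin> T \<Longrightarrow> z \<in> \<Omega> \<Longrightarrow> P \<sigma> z = 0"
    using finite_orderE[OF assms(2)] by blast
  have "finite_order \<Omega> (mult_op a)" for a :: "('a, 'b) jfun"
    by (rule finite_orderI[of "{\<lambda>_. 0}"]) (auto simp: mult_op_def)
  then have "finite_order \<Omega> (multi_pow tot_comp \<sigma> (mult_op (P \<sigma>)))" for \<sigma>
    by (rule finite_order_multi_pow[OF assms(1)])
  then have "\<forall>\<sigma>. \<exists>K. finite K \<and> (\<forall>\<tau>. \<tau> \<notin> K \<longrightarrow> (\<forall>z\<in>\<Omega>. multi_pow tot_comp \<sigma> (mult_op (P \<sigma>)) \<tau> z = 0))"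
    unfolding finite_order_def by (rule allI)
  then obtain K where K: "\<And>\<sigma>. finite (K \<sigma>)"
    "\<And>\<sigma> \<tau> z. \<tau> \<notin> K \<sigma> \<Longrightarrow> z \<in> \<Omega> \<Longrightarrow> multi_pow tot_comp \<sigma> (mult_op (P \<sigma>)) \<tau> z = 0" by metis
  show ?thesis
  proof (rule finite_orderI)
    show "finite (\<Union>\<sigma>\<in>T. K \<sigma>)" using T K by auto
    fix \<tau> z assume \<tau>: "\<tau> \<notin> (\<Union>\<sigma>\<in>T. K \<sigma>)" and z: "z \<in> \<Omega>"
    have "multi_pow tot_comp \<sigma> (mult_op (P \<sigma>)) \<tau> z = 0" for \<sigma>
    proof (cases "\<sigma> \<in> T")
      case True
      then show ?thesis using K \<tau> z by auto
    next
      case False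
      \<comment> \<open>Outside \<open>T\<close> the coefficient vanishes on all of
        \<open>\<Omega>\<close>, hence so do all its total derivatives, and only the finitely many
        \<open>K \<sigma>\<close> with \<open>\<sigma> \<in> T\<close> count.\<close>
      then show ?thesis using T(2) z by (intro multi_pow_tot_comp_eq_0[OF assms(1)]) (auto simp: mult_op_def)
    qed
    then show "dop_adjoint P \<tau> z = 0" by (simp add: dop_adjoint_def)
  qed
qed

text \<open>\<open>meromorphic_function\<close> supplies one finite set of coordinates valid on all
  of \<open>\<Omega>\<close>; partial derivatives in other directions vanish.\<close>

lemma finite_order_linearization:
  assumes "open \<Omega>" "meromorphic_function \<Omega> (F I)"
  shows "finite_order \<Omega> (linearization F I \<alpha>)"
proof -
  obtain T where T: "finite T" "depends_only \<Omega> T (F I)"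
    using assms(2) unfolding meromorphic_function_def by blast
  show ?thesis
  proof (rule finite_orderI)
    show "finite (Dep \<alpha> -` T)" using T(1) by (intro finite_vimageI) (auto simp: inj_on_def)
    show "linearization F I \<alpha> \<sigma> z = 0" if "\<sigma> \<notin> Dep \<alpha> -` T" "z \<in> \<Omega>" for \<sigma> z
      using depends_only_partial_0[OF assms(1) T(2)] that by (simp add: linearization_def)
  qed
qed

lemma finite_order_sum:
  assumes "finite I" "\<And>i. i \<in> I \<Longrightarrow> finite_order \<Omega> (P i)"
  shows "finite_order \<Omega> (\<lambda>\<tau> z. \<Sum>i\<in>I. P i \<tau> z)"
proof -
  obtain T where T: "\<And>i. i \<in> I \<Longrightarrow> finite (T i)" "\<And>i \<tau> z. i \<in> I \<Longrightarrow> \<tau> \<notin> T i \<Longrightarrow> z \<in> \<Omega> \<Longrightarrow> P i \<tau> z = 0"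
    using assms(2) unfolding finite_order_def by metis
  show ?thesis
    by (rule finite_orderI[of "\<Union>i\<in>I. T i"]) (use assms(1) T in auto)
qed

lemma finite_order_diff:
  assumes "finite_order \<Omega> P" "finite_order \<Omega> Q"
  shows "finite_order \<Omega> (\<lambda>\<tau> z. P \<tau> z - Q \<tau> z)"
proof -
  obtain T where T: "finite T" "\<And>\<tau> z. \<tau> \<notin> T \<Longrightarrow> z \<in> \<Omega> \<Longrightarrow> P \<tau> z = 0"
    using finite_orderE[OF assms(1)] by blast
  obtain K where K: "finite K" "\<And>\<tau> z. \<tau> \<notin> K \<Longrightarrow> z \<in> \<Omega> \<Longrightarrow> Q \<tau> z = 0"
    using finite_orderE[OF assms(2)] by blast
  show ?thesis by (rule finite_orderI[of "T \<union> K"]) (use T K in auto)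
qed

lemma finite_order_first_order: "finite_order \<Omega> (first_order C0 C r s)"
  by (rule finite_orderI[of "insert (\<lambda>_. 0) (range (\<lambda>j i. if i = j then 1 else 0))"])
     (auto simp: first_order_def intro!: sum.neutral)

text \<open>Ensures that applying the operator to a generically regular function yields one that can
  be differentiated again.\<close>

definition regular_coeffs :: "('d, 'n) jet set \<Rightarrow> ('d, 'n) dop \<Rightarrow> bool" where
  "regular_coeffs S P \<longleftrightarrow> (\<forall>\<tau>. generically_regular S (P \<tau>))"

lemma regular_coeffs_first_order:
  fixes C :: "'d :: finite \<Rightarrow> 'r \<Rightarrow> 's \<Rightarrow> ('d, 'n) jfun"
  assumes "\<And>r s. generically_regular S (C0 r s)" "\<And>j r s. generically_regular S (C j r s)"
  shows "regular_coeffs S (first_order C0 C r s)"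
  unfolding regular_coeffs_def
proof
  fix \<tau> :: "'d :: finite \<Rightarrow> nat"
  have "generically_regular S (\<lambda>z. if \<tau> = (\<lambda>_. 0) then C0 r s z else 0)"
    using assms(1) generically_regular_const[of S 0] by (cases "\<tau> = (\<lambda>_. 0)") simp_all
  moreover have "generically_regular S (\<lambda>z. if \<tau> = (\<lambda>i. if i = j then 1 else 0) then C j r s z else 0)" for j
    using assms(2) generically_regular_const[of S 0] by (cases "\<tau> = (\<lambda>i. if i = j then 1 else 0)") simp_all
  ultimately show "generically_regular S (first_order C0 C r s \<tau>)"
    unfolding first_order_def by (intro generically_regular_add generically_regular_sum)
qed

lemma generically_regular_scalar_mat:
  "generically_regular S a \<Longrightarrow> generically_regular S (scalar_mat a r s)"
  unfolding scalar_mat_def by (cases "r = s") (simp_all add: generically_regular_const)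

lemma generically_regular_tot: "generically_regular S f \<Longrightarrow> generically_regular S (tot j f)"
  unfolding generically_regular_def by (erule generically_mono) (rule regular_tot)

lemma regular_coeffs_tot_comp:
  assumes "regular_coeffs S Q"
  shows "regular_coeffs S (tot_comp j Q)"
  unfolding regular_coeffs_def
proof
  fix \<tau>
  have "generically_regular S (\<lambda>z. if \<tau> j > 0 then Q (\<tau>(j := \<tau> j - 1)) z else 0)"
    using assms generically_regular_const[of S 0] by (cases "\<tau> j > 0") (simp_all add: regular_coeffs_def)
  then show "generically_regular S (tot_comp j Q \<tau>)"
    using assms unfolding tot_comp_def
    by (intro generically_regular_add generically_regular_tot) (simp_all add: regular_coeffs_def)
qed

lemma regular_coeffs_multi_pow: "regular_coeffs S Q \<Longrightarrow> regular_coeffs S (multi_pow tot_comp \<sigma> Q)"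
  by (rule multi_pow_closed[of "regular_coeffs S"]) (rule regular_coeffs_tot_comp)

lemma regular_coeffs_dop_comp:
  assumes "open \<Omega>" "S \<subseteq> \<Omega>" "finite_order \<Omega> P" "finite_order \<Omega> Q"
    and "regular_coeffs S P" "regular_coeffs S Q"
  shows "regular_coeffs S (dop_comp P Q)"
proof -
  obtain T K where *: "finite T" "finite K"
    "\<And>\<sigma> z. \<sigma> \<notin> T \<Longrightarrow> z \<in> \<Omega> \<Longrightarrow> P \<sigma> z = 0"
    "\<And>\<sigma> \<tau> z. \<sigma> \<in> T \<Longrightarrow> \<tau> \<notin> K \<Longrightarrow> z \<in> \<Omega> \<Longrightarrow> multi_pow tot_comp \<sigma> Q \<tau> z = 0"
    "\<And>\<tau> z. z \<in> \<Omega> \<Longrightarrow> dop_comp P Q \<tau> z = (\<Sum>\<sigma>\<in>T. P \<sigma> z * multi_pow tot_comp \<sigma> Q \<tau> z)"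
    using dop_comp_expand[OF assms(1,3,4)] by blast
  have "generically_regular S (\<lambda>z. \<Sum>\<sigma>\<in>T. P \<sigma> z * multi_pow tot_comp \<sigma> Q \<tau> z)" for \<tau>
    using assms(5) regular_coeffs_multi_pow[OF assms(6)] unfolding regular_coeffs_def
    by (intro generically_regular_sum generically_regular_mult) auto
  then have "generically_regular S (dop_comp P Q \<tau>)" for \<tau>
    by (rule generically_regular_cong[OF assms(1,2), rotated]) (simp add: *(5))
  then show ?thesis by (simp add: regular_coeffs_def)
qed

lemma regular_coeffs_sum:
  "(\<And>i. i \<in> I \<Longrightarrow> regular_coeffs S (P i)) \<Longrightarrow> regular_coeffs S (\<lambda>\<tau> z. \<Sum>i\<in>I. P i \<tau> z)"
  unfolding regular_coeffs_def by (intro allI generically_regular_sum) simp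

lemma regular_coeffs_diff:
  assumes "regular_coeffs S P" "regular_coeffs S Q"
  shows "regular_coeffs S (\<lambda>\<tau> z. P \<tau> z - Q \<tau> z)"
proof -
  have "generically_regular S (\<lambda>z. P \<tau> z + (-1) * Q \<tau> z)" for \<tau>
    using assms unfolding regular_coeffs_def
    by (intro generically_regular_add generically_regular_mult generically_regular_const) auto
  then show ?thesis by (simp add: regular_coeffs_def)
qed

section \<open>Matrix operators\<close>

lemma finite_order_mop_comp:
  "open \<Omega> \<Longrightarrow> (\<And>r s. finite_order \<Omega> (P r s)) \<Longrightarrow> (\<And>s t. finite_order \<Omega> (Q s t)) \<Longrightarrow>
    finite_order \<Omega> ((P \<odot> Q) r t)"
  unfolding mop_comp_def by (intro finite_order_sum finite_order_dop_comp) auto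

lemma finite_order_mop_diff:
  "finite_order \<Omega> (P r s) \<Longrightarrow> finite_order \<Omega> (Q r s) \<Longrightarrow> finite_order \<Omega> ((P \<ominus> Q) r s)"
  unfolding mop_diff_def by (rule finite_order_diff)

lemma regular_coeffs_mop_comp:
  assumes "open \<Omega>" "S \<subseteq> \<Omega>"
    and "\<And>r s. finite_order \<Omega> (P r s)" "\<And>s t. finite_order \<Omega> (Q s t)"
    and "\<And>r s. regular_coeffs S (P r s)" "\<And>s t. regular_coeffs S (Q s t)"
  shows "regular_coeffs S ((P \<odot> Q) r t)"
  unfolding mop_comp_def by (intro regular_coeffs_sum regular_coeffs_dop_comp[where \<Omega> = \<Omega>] assms)

lemma regular_coeffs_mop_diff:
  "regular_coeffs S (P r s) \<Longrightarrow> regular_coeffs S (Q r s) \<Longrightarrow> regular_coeffs S ((P \<ominus> Q) r s)"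
  unfolding mop_diff_def by (rule regular_coeffs_diff)


section \<open>Operators acting on functions on a covering\<close>

locale covering =
  fixes \<Omega> :: "('d :: {finite, linorder}, 'n) jet set" and F :: "'m \<Rightarrow> ('d, 'n) jfun"
    and \<Omega>' :: "('d, 'n, 'w) cpt set" and X :: "'d \<Rightarrow> 'w \<Rightarrow> ('d, 'n, 'w) cfun"
  assumes open_jets: "open \<Omega>" and system: "regular_system \<Omega> F"
    and covering: "differential_covering \<Omega> F \<Omega>' X"
begin

abbreviation Sol :: "('d, 'n) jet set" where
  "Sol \<equiv> solution_set \<Omega> F"

abbreviation CSol :: "('d, 'n, 'w) cpt set" where
  "CSol \<equiv> cov_solution_set \<Omega> F \<Omega>'"

lemma open_cov: "open \<Omega>'"
  using covering by (simp add: differential_covering_def)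

lemma base_in: "z \<in> \<Omega>' \<Longrightarrow> base z \<in> \<Omega>"
  using covering by (auto simp: differential_covering_def)

lemma CSol_subset: "CSol \<subseteq> \<Omega>'"
  by (auto simp: cov_solution_set_def)

sublocale flat_fields CSol "cov_field X"
  by (rule flat_fields_covering[OF system covering])

lemma dop_app_DD: "dop_app X P f z = Sum_any (\<lambda>\<sigma>. P \<sigma> (base z) * DD \<sigma> f z)"
  by (simp add: dop_app_def cov_tot_def[abs_def])

lemma dop_app_eq_sum:
  assumes "finite T" "\<And>\<tau> z. \<tau> \<notin> T \<Longrightarrow> z \<in> \<Omega> \<Longrightarrow> P \<tau> z = 0" "z \<in> \<Omega>'"
  shows "dop_app X P f z = (\<Sum>\<tau>\<in>T. P \<tau> (base z) * DD \<tau> f z)"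
  unfolding dop_app_DD using assms base_in by (intro Sum_any.expand_superset) auto

lemma dop_app_closed:
  assumes P: "finite_order \<Omega> P" "regular_coeffs Sol P" and f: "generically_regular CSol f"
  shows "generically_regular CSol (dop_app X P f)"
proof -
  obtain T where T: "finite T" "\<And>\<tau> z. \<tau> \<notin> T \<Longrightarrow> z \<in> \<Omega> \<Longrightarrow> P \<tau> z = 0"
    using finite_orderE[OF P(1)] by blast
  show ?thesis
  proof (rule generically_regular_cong[OF open_cov CSol_subset])
    show "generically_regular CSol (\<lambda>z. \<Sum>\<tau>\<in>T. P \<tau> (base z) * DD \<tau> f z)"
      using P(2) unfolding regular_coeffs_def
      by (intro generically_regular_sum generically_regular_mult generically_regular_base open_cov DD_closed f) auto
  qed (rule dop_app_eq_sum[OF T, symmetric])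
qed

lemma dop_app_cong:
  assumes P: "finite_order \<Omega> P"
    and "generically_regular CSol f" "generically_regular CSol g" "eq_on CSol f g"
  shows "eq_on CSol (dop_app X P f) (dop_app X P g)"
proof -
  obtain T where T: "finite T" "\<And>\<tau> z. \<tau> \<notin> T \<Longrightarrow> z \<in> \<Omega> \<Longrightarrow> P \<tau> z = 0"
    using finite_orderE[OF P] by blast
  have "eq_on CSol (dop_app X P f) (\<lambda>z. \<Sum>\<tau>\<in>T. P \<tau> (base z) * DD \<tau> f z)"
    using CSol_subset by (intro eq_on_eq dop_app_eq_sum T) auto
  also have "eq_on CSol \<dots> (\<lambda>z. \<Sum>\<tau>\<in>T. P \<tau> (base z) * DD \<tau> g z)"
    using assms by (intro eq_on_sum T eq_on_mult_left DD_cong)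
  also have "eq_on CSol \<dots> (dop_app X P g)"
    using CSol_subset by (intro eq_on_eq dop_app_eq_sum[symmetric] T) auto
  finally show ?thesis .
qed

lemma dop_app_sum:
  assumes P: "finite_order \<Omega> P" and I: "finite I" "\<And>i. i \<in> I \<Longrightarrow> generically_regular CSol (f i)"
  shows "eq_on CSol (dop_app X P (\<lambda>z. \<Sum>i\<in>I. f i z)) (\<lambda>z. \<Sum>i\<in>I. dop_app X P (f i) z)"
proof -
  obtain T where T: "finite T" "\<And>\<tau> z. \<tau> \<notin> T \<Longrightarrow> z \<in> \<Omega> \<Longrightarrow> P \<tau> z = 0"
    using finite_orderE[OF P] by blast
  have "eq_on CSol (dop_app X P (\<lambda>z. \<Sum>i\<in>I. f i z)) (\<lambda>z. \<Sum>\<tau>\<in>T. P \<tau> (base z) * DD \<tau> (\<lambda>z. \<Sum>i\<in>I. f i z) z)"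
    using CSol_subset by (intro eq_on_eq dop_app_eq_sum T) auto
  also have "eq_on CSol \<dots> (\<lambda>z. \<Sum>\<tau>\<in>T. P \<tau> (base z) * (\<Sum>i\<in>I. DD \<tau> (f i) z))"
    by (intro eq_on_sum T eq_on_mult_left DD_sum I)
  also have "eq_on CSol \<dots> (\<lambda>z. \<Sum>i\<in>I. dop_app X P (f i) z)"
  proof (rule eq_on_eq)
    fix z assume "z \<in> CSol"
    then have "z \<in> \<Omega>'" using CSol_subset by blast
    then show "(\<Sum>\<tau>\<in>T. P \<tau> (base z) * (\<Sum>i\<in>I. DD \<tau> (f i) z)) = (\<Sum>i\<in>I. dop_app X P (f i) z)"
      by (simp add: dop_app_eq_sum[OF T] sum_distrib_left sum.swap[of _ I T])
  qed
  finally show ?thesis .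
qed

text \<open>The Leibniz rule on the covering. Coefficients are pulled back from the jets, so
  \<open>D j\<close> acts on them as \<open>tot j\<close>; on \<open>DD \<tau> f\<close> it raises
  the multi-index by \<open>D_DD\<close>. These are the two terms in the definition of
  \<open>tot_comp\<close>.\<close>

lemma dop_app_tot_comp:
  assumes Q: "finite_order \<Omega> Q" "regular_coeffs Sol Q" and f: "generically_regular CSol f"
  shows "eq_on CSol (dop_app X (tot_comp j Q) f) (D j (dop_app X Q f))"
proof -
  obtain T where T: "finite T" "\<And>\<tau> z. \<tau> \<notin> T \<Longrightarrow> z \<in> \<Omega> \<Longrightarrow> Q \<tau> z = 0"
    using finite_orderE[OF Q(1)] by blast
  define s where "s = (\<lambda>\<tau> :: 'd \<Rightarrow> nat. \<tau>(j := Suc (\<tau> j)))"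
  have inj_s: "inj_on s T"
  proof (rule inj_onI)
    fix \<sigma> \<tau> assume *: "s \<sigma> = s \<tau>"
    show "\<sigma> = \<tau>"
    proof
      fix i show "\<sigma> i = \<tau> i" using fun_cong[OF *, of i] by (cases "i = j") (simp_all add: s_def)
    qed
  qed
  let ?q = "\<lambda>\<tau> z. Q \<tau> (base z)"
  have reg_q: "generically_regular CSol (?q \<tau>)" for \<tau>
    using Q(2) unfolding regular_coeffs_def by (intro generically_regular_base open_cov) auto
  have D_q: "D j (?q \<tau>) z = tot j (Q \<tau>) (base z)" for \<tau> z
    using cov_tot_base[of X j "Q \<tau>" z] by (simp add: cov_tot_def)
  have "D j (dop_app X Q f) z = D j (\<lambda>z. \<Sum>\<tau>\<in>T. ?q \<tau> z * DD \<tau> f z) z" if "z \<in> CSol" for z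
    using that CSol_subset by (intro lie_cong[OF open_cov] dop_app_eq_sum[OF T]) auto
  then have "eq_on CSol (D j (dop_app X Q f)) (D j (\<lambda>z. \<Sum>\<tau>\<in>T. ?q \<tau> z * DD \<tau> f z))"
    by (rule eq_on_eq)
  also have "eq_on CSol \<dots> (\<lambda>z. \<Sum>\<tau>\<in>T. D j (\<lambda>z. ?q \<tau> z * DD \<tau> f z) z)"
    by (intro D_sum T generically_regular_mult reg_q DD_closed f)
  also have "eq_on CSol \<dots> (\<lambda>z. \<Sum>\<tau>\<in>T. tot j (Q \<tau>) (base z) * DD \<tau> f z + ?q \<tau> z * DD (s \<tau>) f z)"
  proof (intro eq_on_sum T)
    fix \<tau>
    have "generically CSol (\<lambda>z. D j (\<lambda>z. ?q \<tau> z * DD \<tau> f z) z = D j (?q \<tau>) z * DD \<tau> f z + ?q \<tau> z * D j (DD \<tau> f) z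
        \<and> D j (DD \<tau> f) z = DD (s \<tau>) f z)"
      using D_mult[OF reg_q DD_closed[OF f]] D_DD[OF f] unfolding eq_on_def s_def
      by (intro generically_conj)
    then show "eq_on CSol (D j (\<lambda>z. ?q \<tau> z * DD \<tau> f z))
        (\<lambda>z. tot j (Q \<tau>) (base z) * DD \<tau> f z + ?q \<tau> z * DD (s \<tau>) f z)"
      unfolding eq_on_def by (rule generically_mono) (simp add: D_q)
  qed
  also have "eq_on CSol \<dots> (dop_app X (tot_comp j Q) f)"
  proof (rule eq_on_eq)
    fix z assume "z \<in> CSol"
    then have z: "z \<in> \<Omega>'" "base z \<in> \<Omega>" using CSol_subset base_in by auto
    let ?r = "\<lambda>\<tau>. if \<tau> j > 0 then Q (\<tau>(j := \<tau> j - 1)) (base z) else 0"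
    have r_s: "?r (s \<tau>) = ?q \<tau> z" for \<tau> by (simp add: s_def)
    have r_0: "?r \<tau> = 0" if "\<tau> \<notin> s ` T" for \<tau>
    proof (cases "\<tau> j > 0")
      case True
      then have "\<tau> = s (\<tau>(j := \<tau> j - 1))" by (simp add: s_def)
      then have "\<tau>(j := \<tau> j - 1) \<notin> T" using that by blast
      then show ?thesis using T(2) z by simp
    qed simp
    have t_0: "tot j (Q \<tau>) (base z) = 0" if "\<tau> \<notin> T" for \<tau>
      using that z T(2) by (intro tot_eq_0[OF open_jets]) auto
    have "(tot j (Q \<tau>) (base z) + ?r \<tau>) * DD \<tau> f z = 0" if "\<tau> \<notin> T \<union> s ` T" for \<tau>
      using t_0[of \<tau>] r_0[of \<tau>] that by (simp only: Un_iff de_Morgan_disj) simp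
    then have "dop_app X (tot_comp j Q) f z = (\<Sum>\<tau>\<in>T \<union> s ` T. (tot j (Q \<tau>) (base z) + ?r \<tau>) * DD \<tau> f z)"
      unfolding dop_app_DD tot_comp_def using T(1) by (intro Sum_any.expand_superset) blast+
    also have "\<dots> = (\<Sum>\<tau>\<in>T \<union> s ` T. tot j (Q \<tau>) (base z) * DD \<tau> f z) + (\<Sum>\<tau>\<in>T \<union> s ` T. ?r \<tau> * DD \<tau> f z)"
      by (simp add: ring_distribs sum.distrib)
    also have "(\<Sum>\<tau>\<in>T \<union> s ` T. tot j (Q \<tau>) (base z) * DD \<tau> f z) = (\<Sum>\<tau>\<in>T. tot j (Q \<tau>) (base z) * DD \<tau> f z)"
      by (rule sum.mono_neutral_right) (use T(1) t_0 in auto)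
    also have "(\<Sum>\<tau>\<in>T \<union> s ` T. ?r \<tau> * DD \<tau> f z) = (\<Sum>\<tau>\<in>s ` T. ?r \<tau> * DD \<tau> f z)"
      by (rule sum.mono_neutral_right) (use T(1) r_0 in auto)
    also have "\<dots> = (\<Sum>\<tau>\<in>T. ?q \<tau> z * DD (s \<tau>) f z)"
      by (simp only: sum.reindex[OF inj_s] o_def r_s)
    finally show "(\<Sum>\<tau>\<in>T. tot j (Q \<tau>) (base z) * DD \<tau> f z + ?q \<tau> z * DD (s \<tau>) f z) =
        dop_app X (tot_comp j Q) f z" by (simp add: sum.distrib)
  qed
  finally show ?thesis by (rule eq_on_sym)
qed

text \<open>The relation couples an operator with the function it produces from the fixed
  \<open>f\<close>. Regularity of both is carried along, since a generic equality can be
  differentiated only between regular functions.\<close>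

lemma dop_app_multi_pow:
  assumes Q: "finite_order \<Omega> Q" "regular_coeffs Sol Q" and f: "generically_regular CSol f"
  shows "eq_on CSol (dop_app X (multi_pow tot_comp \<sigma> Q) f) (DD \<sigma> (dop_app X Q f))"
proof -
  let ?R = "\<lambda>Q g. finite_order \<Omega> Q \<and> regular_coeffs Sol Q \<and> generically_regular CSol g \<and>
    eq_on CSol (dop_app X Q f) g"
  have "?R (multi_pow tot_comp \<sigma> Q) (DD \<sigma> (dop_app X Q f))"
  proof (rule multi_pow_rel[of ?R])
    fix j Q g assume R: "?R Q g"
    have "eq_on CSol (dop_app X (tot_comp j Q) f) (D j (dop_app X Q f))"
      using R f by (intro dop_app_tot_comp) auto
    also have "eq_on CSol \<dots> (D j g)"
      using R f by (intro D_cong dop_app_closed) auto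
    finally show "?R (tot_comp j Q) (D j g)"
      using R open_jets finite_order_tot_comp regular_coeffs_tot_comp D_closed by auto
  qed (use assms dop_app_closed eq_on_refl in auto)
  then show ?thesis by blast
qed

text \<open>Composition moves the derivatives of \<open>P\<close> past the coefficients of
  \<open>Q\<close>. Only the latter are differentiated, hence the condition
  \<open>regular_coeffs\<close> on \<open>Q\<close>.\<close>

lemma dop_app_comp:
  assumes P: "finite_order \<Omega> P" and Q: "finite_order \<Omega> Q" "regular_coeffs Sol Q"
    and f: "generically_regular CSol f"
  shows "eq_on CSol (dop_app X (dop_comp P Q) f) (dop_app X P (dop_app X Q f))"
proof -
  obtain T K where *: "finite T" "finite K"
    "\<And>\<sigma> z. \<sigma> \<notin> T \<Longrightarrow> z \<in> \<Omega> \<Longrightarrow> P \<sigma> z = 0"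
    "\<And>\<sigma> \<tau> z. \<sigma> \<in> T \<Longrightarrow> \<tau> \<notin> K \<Longrightarrow> z \<in> \<Omega> \<Longrightarrow> multi_pow tot_comp \<sigma> Q \<tau> z = 0"
    "\<And>\<tau> z. z \<in> \<Omega> \<Longrightarrow> dop_comp P Q \<tau> z = (\<Sum>\<sigma>\<in>T. P \<sigma> z * multi_pow tot_comp \<sigma> Q \<tau> z)"
    using dop_comp_expand[OF open_jets P Q(1)] by blast
  have "eq_on CSol (dop_app X (dop_comp P Q) f)
      (\<lambda>z. \<Sum>\<sigma>\<in>T. P \<sigma> (base z) * dop_app X (multi_pow tot_comp \<sigma> Q) f z)"
  proof (rule eq_on_eq)
    fix z assume "z \<in> CSol"
    then have z: "z \<in> \<Omega>'" "base z \<in> \<Omega>" using CSol_subset base_in by auto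
    have "dop_app X (dop_comp P Q) f z = (\<Sum>\<tau>\<in>K. dop_comp P Q \<tau> (base z) * DD \<tau> f z)"
      using *(2) _ z(1) by (rule dop_app_eq_sum) (simp add: *(4,5))
    also have "\<dots> = (\<Sum>\<tau>\<in>K. \<Sum>\<sigma>\<in>T. P \<sigma> (base z) * (multi_pow tot_comp \<sigma> Q \<tau> (base z) * DD \<tau> f z))"
      by (simp add: *(5)[OF z(2)] sum_distrib_right mult.assoc)
    also have "\<dots> = (\<Sum>\<sigma>\<in>T. P \<sigma> (base z) * (\<Sum>\<tau>\<in>K. multi_pow tot_comp \<sigma> Q \<tau> (base z) * DD \<tau> f z))"
      by (subst sum.swap) (simp add: sum_distrib_left)
    also have "\<dots> = (\<Sum>\<sigma>\<in>T. P \<sigma> (base z) * dop_app X (multi_pow tot_comp \<sigma> Q) f z)"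
      using dop_app_eq_sum[OF *(2) *(4) z(1)] by simp
    finally show "dop_app X (dop_comp P Q) f z =
        (\<Sum>\<sigma>\<in>T. P \<sigma> (base z) * dop_app X (multi_pow tot_comp \<sigma> Q) f z)" .
  qed
  also have "eq_on CSol \<dots> (\<lambda>z. \<Sum>\<sigma>\<in>T. P \<sigma> (base z) * DD \<sigma> (dop_app X Q f) z)"
    by (intro eq_on_sum * eq_on_mult_left dop_app_multi_pow Q f)
  also have "eq_on CSol \<dots> (dop_app X P (dop_app X Q f))"
    using CSol_subset by (intro eq_on_eq dop_app_eq_sum[symmetric] *) auto
  finally show ?thesis .
qed

lemma dop_app_op_sum:
  assumes "finite I" "\<And>i. i \<in> I \<Longrightarrow> finite_order \<Omega> (P i)" "z \<in> \<Omega>'"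
  shows "dop_app X (\<lambda>\<tau> z. \<Sum>i\<in>I. P i \<tau> z) f z = (\<Sum>i\<in>I. dop_app X (P i) f z)"
proof -
  obtain T where T: "\<And>i. i \<in> I \<Longrightarrow> finite (T i)" "\<And>i \<tau> z. i \<in> I \<Longrightarrow> \<tau> \<notin> T i \<Longrightarrow> z \<in> \<Omega> \<Longrightarrow> P i \<tau> z = 0"
    using assms(2) unfolding finite_order_def by metis
  define K where "K = (\<Union>i\<in>I. T i)"
  have K: "finite K" "\<And>i \<tau> z. i \<in> I \<Longrightarrow> \<tau> \<notin> K \<Longrightarrow> z \<in> \<Omega> \<Longrightarrow> P i \<tau> z = 0"
    using T assms(1) by (auto simp: K_def)
  have "dop_app X (\<lambda>\<tau> z. \<Sum>i\<in>I. P i \<tau> z) f z = (\<Sum>\<tau>\<in>K. (\<Sum>i\<in>I. P i \<tau> (base z)) * DD \<tau> f z)"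
    using K by (intro dop_app_eq_sum assms(3)) auto
  also have "\<dots> = (\<Sum>i\<in>I. \<Sum>\<tau>\<in>K. P i \<tau> (base z) * DD \<tau> f z)"
    by (simp add: sum_distrib_right sum.swap[of _ I K])
  also have "\<dots> = (\<Sum>i\<in>I. dop_app X (P i) f z)"
    using dop_app_eq_sum[OF K(1) K(2) assms(3)] by simp
  finally show ?thesis .
qed

lemma dop_app_op_diff:
  assumes "finite_order \<Omega> P" "finite_order \<Omega> Q" "z \<in> \<Omega>'"
  shows "dop_app X (\<lambda>\<tau> z. P \<tau> z - Q \<tau> z) f z = dop_app X P f z - dop_app X Q f z"
proof -
  obtain T where T: "finite T" "\<And>\<tau> z. \<tau> \<notin> T \<Longrightarrow> z \<in> \<Omega> \<Longrightarrow> P \<tau> z = 0"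
    using finite_orderE[OF assms(1)] by blast
  obtain K where K: "finite K" "\<And>\<tau> z. \<tau> \<notin> K \<Longrightarrow> z \<in> \<Omega> \<Longrightarrow> Q \<tau> z = 0"
    using finite_orderE[OF assms(2)] by blast
  have "dop_app X P f z = (\<Sum>\<tau>\<in>T \<union> K. P \<tau> (base z) * DD \<tau> f z)"
    "dop_app X Q f z = (\<Sum>\<tau>\<in>T \<union> K. Q \<tau> (base z) * DD \<tau> f z)"
    "dop_app X (\<lambda>\<tau> z. P \<tau> z - Q \<tau> z) f z = (\<Sum>\<tau>\<in>T \<union> K. (P \<tau> (base z) - Q \<tau> (base z)) * DD \<tau> f z)"
    by (rule dop_app_eq_sum[OF finite_UnI[OF T(1) K(1)] _ assms(3)]; simp add: T(2) K(2))+
  then show ?thesis by (simp add: left_diff_distrib sum_subtractf)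
qed

section \<open>Matrix operators acting on vector functions\<close>

lemma mop_app_closed:
  assumes "\<And>r s. finite_order \<Omega> (P r s)" "\<And>r s. regular_coeffs Sol (P r s)"
    and "\<And>s. generically_regular CSol (f s)"
  shows "generically_regular CSol (mop_app X P f r)"
  unfolding mop_app_def by (intro generically_regular_sum dop_app_closed assms)

lemma mop_app_cong:
  assumes "\<And>r s. finite_order \<Omega> (P r s)" "\<And>s. generically_regular CSol (f s)"
    and "\<And>s. generically_regular CSol (g s)" "\<And>s. eq_on CSol (f s) (g s)"
  shows "eq_on CSol (mop_app X P f r) (mop_app X P g r)"
  unfolding mop_app_def by (intro eq_on_sum finite dop_app_cong assms)

lemma mop_app_comp:
  assumes P: "\<And>r s. finite_order \<Omega> (P r s)"
    and Q: "\<And>s t. finite_order \<Omega> (Q s t)" "\<And>s t. regular_coeffs Sol (Q s t)"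
    and f: "\<And>t. generically_regular CSol (f t)"
  shows "eq_on CSol (mop_app X (P \<odot> Q) f r) (mop_app X P (mop_app X Q f) r)"
proof -
  have "eq_on CSol (mop_app X (P \<odot> Q) f r)
      (\<lambda>z. \<Sum>t\<in>UNIV. \<Sum>s\<in>UNIV. dop_app X (dop_comp (P r s) (Q s t)) (f t) z)"
  proof (rule eq_on_eq)
    fix z assume "z \<in> CSol"
    then have "z \<in> \<Omega>'" using CSol_subset by blast
    then show "mop_app X (P \<odot> Q) f r z =
        (\<Sum>t\<in>UNIV. \<Sum>s\<in>UNIV. dop_app X (dop_comp (P r s) (Q s t)) (f t) z)"
      unfolding mop_app_def mop_comp_def
      by (intro sum.cong refl dop_app_op_sum finite finite_order_dop_comp open_jets P Q)
  qed
  also have "eq_on CSol \<dots> (\<lambda>z. \<Sum>t\<in>UNIV. \<Sum>s\<in>UNIV. dop_app X (P r s) (dop_app X (Q s t) (f t)) z)"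
    by (intro eq_on_sum finite dop_app_comp P Q f)
  also have "eq_on CSol \<dots> (\<lambda>z. \<Sum>s\<in>UNIV. \<Sum>t\<in>UNIV. dop_app X (P r s) (dop_app X (Q s t) (f t)) z)"
    by (rule eq_on_eq) (rule sum.swap)
  \<comment> \<open>Additivity of each entry of \<open>P\<close> pulls the sum over \<open>t\<close>
    inside its argument, where it forms the component \<open>s\<close> of \<open>Q\<close> applied
    to \<open>f\<close>.\<close>
  also have "eq_on CSol \<dots> (mop_app X P (mop_app X Q f) r)"
    unfolding mop_app_def
    by (intro eq_on_sum finite eq_on_sym[OF dop_app_sum] dop_app_closed P Q f)
  finally show ?thesis .
qed

lemma mop_app_diff:
  assumes "\<And>r s. finite_order \<Omega> (P r s)" "\<And>r s. finite_order \<Omega> (Q r s)"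
  shows "eq_on CSol (mop_app X (P \<ominus> Q) f r) (\<lambda>z. mop_app X P f r z - mop_app X Q f r z)"
proof (rule eq_on_eq)
  fix z assume "z \<in> CSol"
  then have "z \<in> \<Omega>'" using CSol_subset by blast
  then show "mop_app X (P \<ominus> Q) f r z = mop_app X P f r z - mop_app X Q f r z"
    unfolding mop_app_def mop_diff_def by (simp add: dop_app_op_diff assms sum_subtractf)
qed

text \<open>Coefficients enter the application only as multipliers, so their equality at a point
  gives equality of the values there for any \<open>f\<close>.\<close>

lemma mop_app_mop_eq_on:
  assumes P: "\<And>r s. finite_order \<Omega> (P r s)" and Q: "\<And>r s. finite_order \<Omega> (Q r s)"
    and eq: "mop_eq_on Sol P Q"
  shows "eq_on CSol (mop_app X P f r) (mop_app X Q f r)"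
  unfolding mop_app_def
proof (intro eq_on_sum finite)
  fix s
  obtain T where T: "finite T" "\<And>\<tau> z. \<tau> \<notin> T \<Longrightarrow> z \<in> \<Omega> \<Longrightarrow> P r s \<tau> z = 0"
    using finite_orderE[OF P] by blast
  obtain K where K: "finite K" "\<And>\<tau> z. \<tau> \<notin> K \<Longrightarrow> z \<in> \<Omega> \<Longrightarrow> Q r s \<tau> z = 0"
    using finite_orderE[OF Q] by blast
  \<comment> \<open>\<open>mop_eq_on\<close> gives one dense open set for each multi-index; finite
    supports allow a common one.\<close>
  have "generically Sol (\<lambda>z. \<forall>\<tau>\<in>T \<union> K. P r s \<tau> z = Q r s \<tau> z)"
    using eq T(1) K(1) unfolding mop_eq_on_def eq_on_def by (intro generically_ball) auto
  from generically_base[OF open_cov this]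
  show "eq_on CSol (dop_app X (P r s) (f s)) (dop_app X (Q r s) (f s))"
    unfolding eq_on_def
  proof (rule generically_mono)
    fix z assume "z \<in> CSol" and z: "\<forall>\<tau>\<in>T \<union> K. P r s \<tau> (base z) = Q r s \<tau> (base z)"
    then have z': "z \<in> \<Omega>'" using CSol_subset by blast
    have "dop_app X (P r s) (f s) z = (\<Sum>\<tau>\<in>T \<union> K. P r s \<tau> (base z) * DD \<tau> (f s) z)"
      "dop_app X (Q r s) (f s) z = (\<Sum>\<tau>\<in>T \<union> K. Q r s \<tau> (base z) * DD \<tau> (f s) z)"
      by (rule dop_app_eq_sum[OF finite_UnI[OF T(1) K(1)] _ z']; simp add: T(2) K(2))+
    then show "dop_app X (P r s) (f s) z = dop_app X (Q r s) (f s) z" using z by simp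
  qed
qed

lemma mop_app_of_zero: "mop_app X P (\<lambda>_ _. 0) r z = 0"
proof -
  have "DD \<sigma> (\<lambda>_. 0) = (\<lambda>_. 0)" for \<sigma>
    by (rule multi_pow_closed[of "\<lambda>f. f = (\<lambda>_. 0)"]) (auto simp: lie_const)
  then show ?thesis by (simp add: mop_app_def dop_app_DD)
qed

lemma mop_app_zero: "mop_app X mop_zero f r z = 0"
  by (simp add: mop_app_def dop_app_DD mop_zero_def)

end

section \<open>Cosymmetries are sent to cosymmetries\<close>

theorem proposition2:
  fixes \<Omega> :: "('d :: {finite, linorder}, 'n :: finite) jet set"
    and F :: "'m :: finite \<Rightarrow> ('d, 'n) jfun"
    and A0 B0 :: "nat \<Rightarrow> 'm \<Rightarrow> 'm \<Rightarrow> ('d, 'n) jfun"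
    and A1 B1 :: "nat \<Rightarrow> 'd \<Rightarrow> ('d, 'n) jfun"
    and L0 :: "'n \<Rightarrow> 'm \<Rightarrow> ('d, 'n) jfun"
    and L1 :: "'d \<Rightarrow> 'n \<Rightarrow> 'm \<Rightarrow> ('d, 'n) jfun"
    and M0 :: "'m \<Rightarrow> 'n \<Rightarrow> ('d, 'n) jfun"
    and M1 :: "'d \<Rightarrow> 'm \<Rightarrow> 'n \<Rightarrow> ('d, 'n) jfun"
  defines "Sol \<equiv> solution_set \<Omega> F"
    and "A \<equiv> \<lambda>i. first_order (A0 i) (\<lambda>j. scalar_mat (A1 i j))"
    and "B \<equiv> \<lambda>i. first_order (B0 i) (\<lambda>j. scalar_mat (B1 i j))"
    and "L \<equiv> first_order L0 L1"
    and "M \<equiv> first_order M0 M1"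
  assumes dom: "open \<Omega>"
    and F: "\<And>I. meromorphic_function \<Omega> (F I)"
    and submanifold: "regular_system \<Omega> F"
    and A0: "\<And>i I J. i \<in> {1, 2} \<Longrightarrow> meromorphic_along \<Omega> Sol (A0 i I J)"
    and A1: "\<And>i j. i \<in> {1, 2} \<Longrightarrow> meromorphic_along \<Omega> Sol (A1 i j)"
    and B0: "\<And>i I J. i \<in> {1, 2} \<Longrightarrow> meromorphic_along \<Omega> Sol (B0 i I J)"
    and B1: "\<And>i j. i \<in> {1, 2} \<Longrightarrow> meromorphic_along \<Omega> Sol (B1 i j)"
    and L0: "\<And>\<alpha> I. meromorphic_along \<Omega> Sol (L0 \<alpha> I)"
    and L1: "\<And>k \<alpha> I. meromorphic_along \<Omega> Sol (L1 k \<alpha> I)"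
    and M0: "\<And>I \<alpha>. meromorphic_along \<Omega> Sol (M0 I \<alpha>)"
    and M1: "\<And>k I \<alpha>. meromorphic_along \<Omega> Sol (M1 k I \<alpha>)"
    and i: "mop_eq_on Sol (A 1 \<odot> A 2 \<ominus> A 2 \<odot> A 1) mop_zero"
    and ii: "mop_eq_on Sol (B 1 \<odot> B 2 \<ominus> B 2 \<odot> B 1) mop_zero"
    and iii: "mop_eq_on Sol (mop_adjoint (linearization F)) (L \<odot> (B 1 \<odot> A 2 \<ominus> B 2 \<odot> A 1))"
    and iv: "mop_eq_on Sol (A 1 \<odot> B 2 \<ominus> A 2 \<odot> B 1) (M \<odot> mop_adjoint (linearization F))"
    and v: "\<exists>p q. p \<noteq> q \<and> solvable_for Sol A0 A1 p q"
  shows "adjoint_recursion_operator TYPE('w) \<Omega> F A B"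
proof -
  have finAB: "finite_order \<Omega> (A k r s)" "finite_order \<Omega> (B k r s)" for k r s
    by (simp_all add: A_def B_def finite_order_first_order)
  have finL: "finite_order \<Omega> (L r s)" for r s
    by (simp add: L_def finite_order_first_order)
  \<comment> \<open>The assumptions on the coefficients cover the indices 1 and 2 only, hence the
    restriction on \<open>k\<close>, while finite order holds for every index by the shape of
    \<open>first_order\<close>.\<close>
  have regA: "regular_coeffs Sol (A k r s)" and regB: "regular_coeffs Sol (B k r s)" if "k \<in> {1, 2}" for k r s
    unfolding A_def B_def
    by (intro regular_coeffs_first_order generically_regular_scalar_mat that
        meromorphic_along_regular[OF A0] meromorphic_along_regular[OF A1]
        meromorphic_along_regular[OF B0] meromorphic_along_regular[OF B1])+
  have Sol_subset: "Sol \<subseteq> \<Omega>" by (auto simp: Sol_def solution_set_def)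
  let ?E = "mop_adjoint (linearization F)" and ?C = "B 1 \<odot> A 2 \<ominus> B 2 \<odot> A 1"
  have fin_comp: "finite_order \<Omega> ((B k \<odot> A l) r s)" "finite_order \<Omega> ((B k \<odot> B l) r s)" for k l r s
    by (intro finite_order_mop_comp dom finAB)+
  have finE: "finite_order \<Omega> (?E r s)" for r s
    by (simp add: mop_adjoint_def finite_order_adjoint finite_order_linearization dom F)
  have finC: "finite_order \<Omega> (?C r s)" for r s
    by (intro finite_order_mop_diff fin_comp)
  have regC: "regular_coeffs Sol (?C r s)" for r s
    by (intro regular_coeffs_mop_diff regular_coeffs_mop_comp[OF dom Sol_subset] finAB regA regB) simp_all
  show ?thesis
    unfolding adjoint_recursion_operator_def
  proof (intro allI impI)
    fix \<Omega>' and X :: "'d \<Rightarrow> 'w \<Rightarrow> ('d, 'n, 'w) cfun" and \<gamma> \<gamma>'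
    assume cov: "differential_covering \<Omega> F \<Omega>' X" and \<gamma>: "cosymmetry \<Omega> F \<Omega>' X \<gamma>"
      and \<gamma>': "\<forall>I. meromorphic_along \<Omega>' (cov_solution_set \<Omega> F \<Omega>') (\<gamma>' I)"
      and rel: "\<forall>i\<in>{1, 2}. \<forall>I. eq_on (cov_solution_set \<Omega> F \<Omega>') (mop_app X (A i) \<gamma>' I) (mop_app X (B i) \<gamma> I)"
    interpret covering \<Omega> F \<Omega>' X
      using dom submanifold cov by unfold_locales
    have reg\<gamma>: "generically_regular CSol (\<gamma> I)" and reg\<gamma>': "generically_regular CSol (\<gamma>' I)" for I
      using \<gamma> \<gamma>' by (auto simp: cosymmetry_def intro: meromorphic_along_regular)
    note reg = regA[unfolded Sol_def] regB[unfolded Sol_def] regC[unfolded Sol_def]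
    have rel_BB: "eq_on CSol (mop_app X (B k \<odot> A l) \<gamma>' I) (mop_app X (B k \<odot> B l) \<gamma> I)"
      if k: "k \<in> {1, 2}" and l: "l \<in> {1, 2}" for k l I
    proof -
      have "eq_on CSol (mop_app X (B k \<odot> A l) \<gamma>' I) (mop_app X (B k) (mop_app X (A l) \<gamma>') I)"
        by (intro mop_app_comp finAB reg l reg\<gamma>')
      \<comment> \<open>The relation is a generic equality on the covering; placing it under
        \<open>B k\<close> requires both of its sides to be generically regular.\<close>
      also have "eq_on CSol \<dots> (mop_app X (B k) (mop_app X (B l) \<gamma>) I)"
        using rel l by (intro mop_app_cong mop_app_closed finAB reg l reg\<gamma> reg\<gamma>') auto
      also have "eq_on CSol \<dots> (mop_app X (B k \<odot> B l) \<gamma> I)"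
        by (intro eq_on_sym[OF mop_app_comp] finAB reg l reg\<gamma>)
      finally show ?thesis .
    qed
    have C_0: "eq_on CSol (mop_app X ?C \<gamma>' I) (\<lambda>_. 0)" for I
    proof -
      have "eq_on CSol (mop_app X ?C \<gamma>' I) (\<lambda>z. mop_app X (B 1 \<odot> A 2) \<gamma>' I z - mop_app X (B 2 \<odot> A 1) \<gamma>' I z)"
        by (intro mop_app_diff fin_comp)
      also have "eq_on CSol \<dots> (\<lambda>z. mop_app X (B 1 \<odot> B 2) \<gamma> I z - mop_app X (B 2 \<odot> B 1) \<gamma> I z)"
        by (intro eq_on_diff rel_BB) simp_all
      \<comment> \<open>The two values are regrouped as one operator applied to
        \<open>\<gamma>\<close>, because hypothesis (ii) is an identity between
        coefficients.\<close>
      also have "eq_on CSol \<dots> (mop_app X (B 1 \<odot> B 2 \<ominus> B 2 \<odot> B 1) \<gamma> I)"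
        by (intro eq_on_sym[OF mop_app_diff] fin_comp)
      also have "eq_on CSol \<dots> (mop_app X mop_zero \<gamma> I)"
        using ii by (intro mop_app_mop_eq_on finite_order_mop_diff fin_comp finite_orderI[of "{}"])
          (simp_all add: Sol_def mop_zero_def)
      also have "eq_on CSol \<dots> (\<lambda>_. 0)"
        by (rule eq_on_eq) (rule mop_app_zero)
      finally show ?thesis .
    qed
    have "eq_on CSol (mop_app X ?E \<gamma>' \<alpha>) (\<lambda>_. 0)" for \<alpha>
    proof -
      have "eq_on CSol (mop_app X ?E \<gamma>' \<alpha>) (mop_app X (L \<odot> ?C) \<gamma>' \<alpha>)"
        by (rule mop_app_mop_eq_on[OF finE finite_order_mop_comp[OF dom finL finC] iii[unfolded Sol_def]])
      also have "eq_on CSol \<dots> (mop_app X L (mop_app X ?C \<gamma>') \<alpha>)"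
        by (intro mop_app_comp finL finC reg reg\<gamma>')
      \<comment> \<open>The argument of \<open>L\<close> vanishes only at generic points of the
        solution set, so this step again depends on tangency and on the regularity of that
        argument.\<close>
      also have "eq_on CSol \<dots> (mop_app X L (\<lambda>_ _. 0) \<alpha>)"
        by (intro mop_app_cong mop_app_closed finL finC reg reg\<gamma>' C_0 generically_regular_const)
      also have "eq_on CSol \<dots> (\<lambda>_. 0)"
        by (rule eq_on_eq) (rule mop_app_of_zero)
      finally show ?thesis .
    qed
    then show "cosymmetry \<Omega> F \<Omega>' X \<gamma>'"
      using \<gamma>' by (simp add: cosymmetry_def)
  qed
qed

end
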